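(* There exists a positive constant $C$, independent of $m$ and $n$, such that the following holds. Let $m\ge 1$ be an integer and let $n$ be a prime such that $m\mid (n-1)$ and $m\le n^{2/3}$; put $d=2m$ and $N=2n$. Let $g$ be a primitive root modulo $n$ and let $$\Lambda=\{k_1,\dots,k_m\}=\big\{g^0,\,g^{\frac{n-1}{m}},\,g^{\frac{2(n-1)}{m}},\dots,g^{\frac{(m-1)(n-1)}{m}}\big\}\bmod n \subset\{1,\dots,n-1\}.$$ Let $F_\Lambda\in\mathbb{C}^{m\times n}$ be the matrix with entries $(F_\Lambda)_{s,j}=e^{2\pi \mathrm{i} k_s j/n}$ for $1\le s\le m$, $1\le j\le n$, and let $$\boldsymbol{V}=\frac{1}{\sqrt m}\begin{bmatrix}\operatorname{Re}F_\Lambda & -\operatorname{Im}F_\Lambda\\ \operatorname{Im}F_\Lambda & \operatorname{Re}F_\Lambda\end{bmatrix}\in\mathbb{R}^{d\times N},$$ with columns $\boldsymbol{v}_1,\dots,\boldsymbol{v}_N$. Let $\mu(\boldsymbol{V}):=\max_{i\neq j}|\boldsymbol{v}_i^\top\boldsymbol{v}_j|$ be the mutual coherence of $\boldsymbol{V}$. Then $$\mu(\boldsymbol{V})\le C\,m^{-1/2}\,n^{1/6}\,(\log m)^{1/6}.$$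
   Context: Here $\mathrm{i}=\sqrt{-1}$, and $\operatorname{Re}$, $\operatorname{Im}$ are taken entrywise.
   Formalization: The formal theorem assumes m ≥ 2 instead of m ≥ 1, since for m = 1 the right-hand side vanishes (log 1 = 0) while the coherence of V is positive for every prime n. *)

theory Defs
  imports
    "Jordan_Normal_Form.Matrix"
    "HOL-Number_Theory.Residue_Primitive_Roots"
begin

definition subgroup_freqs :: "nat \<Rightarrow> nat \<Rightarrow> nat \<Rightarrow> nat set" where
  "subgroup_freqs n m g = {g ^ (t * ((n - 1) div m)) mod n | t. t < m}"

text \<open>
  Matrix positions are counted from 0, whereas the column index \<open>j\<close> in the exponent
  \<open>k\<^sub>s j\<close> runs over \<open>1, \<dots>, n\<close>; hence the successor below.
\<close>

definition partial_fourier_mat :: "nat \<Rightarrow> nat \<Rightarrow> (nat \<Rightarrow> nat) \<Rightarrow> complex mat" where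
  "partial_fourier_mat m n k =
     mat m n (\<lambda>(s, j). exp (2 * of_real pi * \<i> * of_nat (k s) * of_nat (Suc j) / of_nat n))"

text \<open>
  For \<open>m = 1\<close> the coherence of the matrix below is positive although \<open>ln m = 0\<close>, so an
  upper bound proportional to a positive power of \<open>ln m\<close> is only meaningful for \<open>m \<ge> 2\<close>.
\<close>

definition real_frame_mat :: "nat \<Rightarrow> nat \<Rightarrow> (nat \<Rightarrow> nat) \<Rightarrow> real mat" where
  "real_frame_mat m n k =
     (let F = partial_fourier_mat m n k
      in (1 / sqrt (real m)) \<cdot>\<^sub>m
           four_block_mat (map_mat Re F) (- map_mat Im F)
                          (map_mat Im F) (map_mat Re F))"

lemma real_frame_mat_carrier: "real_frame_mat m n k \<in> carrier_mat (2 * m) (2 * n)"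
  by (auto simp: real_frame_mat_def partial_fourier_mat_def Let_def)

definition mutual_coherence :: "real mat \<Rightarrow> real" where
  "mutual_coherence V =
     Max {\<bar>col V i \<bullet> col V j\<bar> | i j. i < dim_col V \<and> j < dim_col V \<and> i \<noteq> j}"

end

theory Submission
  imports Defs "Berlekamp_Zassenhaus.Finite_Field" "HOL-Analysis.Convex"
begin

text \<open>
  The scalar products of distinct columns are, up to the factor \<open>1 / m\<close>, real parts of
  unimodular multiples of sums \<open>S(a) = \<Sum>h\<in>H. e(a h / n)\<close> over the subgroup \<open>H\<close> of order \<open>m\<close>, so the claim is
  the estimate \<open>\<bar>S(a)\<bar>\<^sup>6 \<le> C n m\<^sup>3 ln m\<close> for \<open>a \<noteq> 0\<close>.
  Splitting \<open>S(a)\<^sup>3\<close> by the product of the three summands, the Cauchy-Schwarz inequality and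
  Parseval's identity bound \<open>\<bar>S(a)\<bar>\<^sup>6\<close> by the number of pairs of triples in \<open>H\<close> with
  equal sums and equal products, and these correspond to collinear triples of points of \<open>H \<times> H\<close>.
  Hence it suffices to bound the third moment, with its main term removed, of the number of
  points of \<open>H \<times> H\<close> on a line. Lines with few points are controlled by the second moment; the
  number of lines with many points is bounded by Stepanov's method.
\<close>

text \<open>When \<open>m\<^sup>2\<close> is much larger than \<open>n\<close>, the collinear
  triples are dominated by a mean part \<open>m ^ 6 / n\<close>, beyond the admissible
  \<open>m ^ 4 * ln m\<close>. This part must cancel exactly and not just up to a constant. On the
  analytic side it is the frequency 0 in Parseval's identity; on the geometric side it comes from
  the mean \<open>m\<^sup>2 / n\<close> of the number of points on a line. Stepanov's polynomial
  vanishes to order \<open>A\<close> at the relevant points, and its nonvanishing is ensured as long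
  as certain degrees near \<open>m\<^sup>2 / A\<close> stay within the characteristic
  \<open>n\<close>. This forces \<open>A\<close> to be at least about \<open>m\<^sup>2 / n\<close>,
  so lines with fewer than a multiple of \<open>m\<^sup>2 / n + 1\<close> points are out of reach.
  That threshold has the order of the mean, or of 1 if the mean is smaller, which is why the second
  moment can take over below it.\<close>

unbundle no inner_syntax

section \<open>Polynomials over fields of positive characteristic\<close>

text \<open>Passing from \<open>f\<close> to \<open>x f' - e f\<close> with
  \<open>e = degree f\<close> removes exactly the leading term: the other coefficients are
  multiplied by \<open>i - e\<close>, nonzero in the field because
  \<open>degree f < CHAR('a)\<close>. The order at 1 drops by at most one, and a single monomial
  does not vanish at 1.\<close>

lemma sparse_poly_order_at_1:
  fixes f :: "'a::field poly"
  assumes "f \<noteq> 0" "degree f < CHAR('a)" "[:-1, 1:] ^ N dvd f"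
  shows "N < card {i. coeff f i \<noteq> 0}"
  using assms
proof (induction N arbitrary: f)
  case 0
  then have "coeff f (degree f) \<noteq> 0" by simp
  moreover have "finite {i. coeff f i \<noteq> 0}"
    by (rule finite_subset[of _ "{..degree f}"]) (auto intro: le_degree)
  ultimately show ?case by (metis (mono_tags, lifting) card_gt_0_iff empty_iff mem_Collect_eq)
next
  case (Suc N)
  define e where "e = degree f"
  define g where "g = [:0, 1:] * pderiv f - smult (of_nat e) f"
  have fin: "finite {i. coeff f i \<noteq> 0}"
    by (rule finite_subset[of _ "{..degree f}"]) (auto intro: le_degree)
  have e: "coeff f e \<noteq> 0" using Suc.prems by (simp add: e_def)
  have cg: "coeff g i = (of_nat i - of_nat e) * coeff f i" for i
    by (cases i) (simp_all add: g_def coeff_pderiv algebra_simps)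
  have nz: "(of_nat i - of_nat e :: 'a) \<noteq> 0" if "coeff f i \<noteq> 0" "i \<noteq> e" for i
  proof
    assume "(of_nat i - of_nat e :: 'a) = 0"
    then have "(of_nat (e - i) :: 'a) = 0"
      using le_degree[OF that(1)] by (simp add: e_def of_nat_diff)
    then have "CHAR('a) dvd e - i" by (simp add: of_nat_eq_0_iff_char_dvd)
    with le_degree[OF that(1)] that(2) Suc.prems(2) show False
      by (metis e_def diff_is_0_eq diff_le_self dvd_imp_le le_antisym le_trans linorder_not_le zero_less_diff)
  qed
  have supp: "{i. coeff g i \<noteq> 0} = {i. coeff f i \<noteq> 0} - {e}"
    using nz by (auto simp: cg)
  have "[:-1, 1:] ^ N dvd pderiv f"
  proof -
    obtain h where h: "f = [:-1, 1:] ^ Suc N * h" using Suc.prems(3) by (elim dvdE)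
    have "pderiv ([:-1, 1:] ^ Suc N :: 'a poly) = smult (of_nat (Suc N)) ([:-1, 1:] ^ N)"
      unfolding pderiv_power_Suc by (simp add: pderiv_pCons)
    then have "pderiv f = [:-1, 1:] ^ N * ([:-1, 1:] * pderiv h + smult (of_nat (Suc N)) h)"
      unfolding h pderiv_mult by (simp only: power_Suc mult_smult_left mult_smult_right algebra_simps)
    then show ?thesis by (rule dvdI)
  qed
  moreover have "[:-1, 1:] ^ N dvd f"
    using Suc.prems(3) by (metis dvd_mult_right power_Suc)
  ultimately have dvd: "[:-1, 1:] ^ N dvd g"
    unfolding g_def by (intro dvd_diff dvd_mult dvd_smult)
  show ?case
  proof (cases "g = 0")
    case True
    then have "{i. coeff f i \<noteq> 0} \<subseteq> {e}" using supp by auto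
    then have "f = monom (coeff f e) e" by (auto simp: poly_eq_iff)
    then have "poly f 1 \<noteq> 0" using e by (metis mult.right_neutral poly_monom power_one)
    moreover have "poly f 1 = 0"
      using Suc.prems(3) by (metis dvd_mult_left poly_eq_0_iff_dvd power_Suc)
    ultimately show ?thesis by simp
  next
    case False
    have "degree g \<le> degree f" by (rule degree_le) (auto simp: cg coeff_eq_0)
    then have "N < card {i. coeff g i \<noteq> 0}"
      using Suc.IH[OF False _ dvd] Suc.prems(2) by simp
    then show ?thesis unfolding supp using e fin by simp
  qed
qed

text \<open>The exponents \<open>a + m * b\<close> are pairwise distinct as
  \<open>a < A \<le> m\<close>, so a nonzero sum has at most \<open>A * B \<le> m\<close> terms and
  degree below \<open>m * B\<close>. By the preceding lemma its order at 1 is then less than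
  \<open>m\<close>.\<close>

lemma fewnomial_dvd_imp_zero:
  fixes F :: "nat \<Rightarrow> nat \<Rightarrow> 'a::field"
  assumes AB: "A * B \<le> m" and mB: "m * B \<le> CHAR('a)" and A: "A \<le> m"
    and dvd: "[:-1, 1:] ^ m dvd (\<Sum>a<A. \<Sum>b<B. monom (F a b) (a + m * b))"
    and ab: "a < A" "b < B"
  shows "F a b = 0"
proof (rule ccontr)
  assume nz: "F a b \<noteq> 0"
  let ?f = "\<Sum>a<A. \<Sum>b<B. monom (F a b) (a + m * b)"
  have inj: "a' + m * b' = a + m * b \<longleftrightarrow> a' = a \<and> b' = b" if "a' < A" for a' b'
  proof
    assume *: "a' + m * b' = a + m * b"
    have "a' = (a' + m * b') mod m" "a = (a + m * b) mod m" using that ab A by auto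
    with * have "a' = a" by simp
    then show "a' = a \<and> b' = b" using * that A by simp
  qed simp
  have cf: "coeff ?f i = (\<Sum>a<A. \<Sum>b<B. if a + m * b = i then F a b else 0)" for i
    by (simp add: coeff_sum)
  have "coeff ?f (a + m * b) = (\<Sum>a'<A. \<Sum>b'<B. if a' = a \<and> b' = b then F a' b' else 0)"
    unfolding cf using inj by (intro sum.cong refl) auto
  also have "\<dots> = (\<Sum>a'<A. if a' = a then F a b else 0)"
    using ab by (intro sum.cong refl) auto
  also have "\<dots> = F a b" using ab by simp
  finally have "coeff ?f (a + m * b) = F a b" .
  with nz have f0: "?f \<noteq> 0" by (metis coeff_0)
  have supp: "{i. coeff ?f i \<noteq> 0} \<subseteq> (\<lambda>(a, b). a + m * b) ` ({..<A} \<times> {..<B})"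
  proof
    fix i assume "i \<in> {i. coeff ?f i \<noteq> 0}"
    then have "coeff ?f i \<noteq> 0" by simp
    have "\<exists>a\<in>{..<A}. \<exists>b\<in>{..<B}. a + m * b = i"
    proof (rule ccontr)
      assume "\<not> (\<exists>a\<in>{..<A}. \<exists>b\<in>{..<B}. a + m * b = i)"
      then have "coeff ?f i = 0" unfolding cf by (intro sum.neutral ballI if_not_P) blast+
      with \<open>coeff ?f i \<noteq> 0\<close> show False by simp
    qed
    then show "i \<in> (\<lambda>(a, b). a + m * b) ` ({..<A} \<times> {..<B})" by force
  qed
  have "card {i. coeff ?f i \<noteq> 0} \<le> card ((\<lambda>(a, b). a + m * b) ` ({..<A} \<times> {..<B}))"
    by (rule card_mono[OF _ supp]) simp
  also have "\<dots> \<le> A * B"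
    using card_image_le[of "{..<A} \<times> {..<B}" "\<lambda>(a, b). a + m * b"] by (simp add: card_cartesian_product)
  finally have "card {i. coeff ?f i \<noteq> 0} \<le> m" using AB by simp
  moreover have "degree ?f < CHAR('a)"
  proof -
    have "degree ?f \<in> {i. coeff ?f i \<noteq> 0}" using f0 by simp
    with supp have "degree ?f \<in> (\<lambda>(a, b). a + m * b) ` ({..<A} \<times> {..<B})" by (rule subsetD)
    then obtain a' b' where "b' < B" "a' < A" "degree ?f = a' + m * b'" by auto
    then have "degree ?f < m + m * b'" using A by simp
    also have "\<dots> \<le> m * B" using \<open>b' < B\<close> by (metis Suc_leI mult_Suc_right mult_le_mono2)
    finally show ?thesis using mB by simp
  qed
  ultimately show False
    using sparse_poly_order_at_1[OF f0 _ dvd] by simp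
qed

text \<open>This makes Stepanov's auxiliary polynomial nonzero. At the least \<open>c\<close> with a
  nonzero coefficient, divide by \<open>?W ^ c\<close>: all later terms keep a factor
  \<open>?W = (1 - x) ^ m\<close>, so it divides the term of index \<open>c\<close> as well, which
  the preceding lemma excludes.\<close>

lemma power_product_polys_independent:
  fixes lam :: "nat \<Rightarrow> nat \<Rightarrow> nat \<Rightarrow> 'a::field"
  assumes AB: "A * B \<le> m" and mB: "m * B \<le> CHAR('a)" and A: "A \<le> m"
    and zero: "(\<Sum>c<B. (\<Sum>a<A. \<Sum>b<B. monom (lam a b c) (a + m * b)) * ([:1, -1:] ^ m) ^ c) = 0"
    and abc: "a < A" "b < B" "c < B"
  shows "lam a b c = 0"
  using abc
proof (induction c arbitrary: a b rule: less_induct)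
  case (less c)
  let ?F = "\<lambda>c. \<Sum>a<A. \<Sum>b<B. monom (lam a b c) (a + m * b)"
  let ?W = "[:1, -1:] ^ m :: 'a poly"
  have low: "?F c' = 0" if "c' < c" for c'
    using less.IH[OF that] that less.prems by (intro sum.neutral ballI) auto
  have "0 = (\<Sum>c'<B. ?F c' * ?W ^ c')" using zero by simp
  also have "\<dots> = (\<Sum>c'\<in>{c..<B}. ?F c' * ?W ^ c')"
    using low by (intro sum.mono_neutral_right) auto
  also have "\<dots> = ?F c * ?W ^ c + (\<Sum>c'\<in>{Suc c..<B}. ?F c' * ?W ^ c')"
    using less.prems by (simp add: sum.atLeast_Suc_lessThan)
  also have "(\<Sum>c'\<in>{Suc c..<B}. ?F c' * ?W ^ c')
      = ?W ^ c * (?W * (\<Sum>c'\<in>{Suc c..<B}. ?F c' * ?W ^ (c' - Suc c)))"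
    unfolding sum_distrib_left
  proof (intro sum.cong refl)
    fix c' assume "c' \<in> {Suc c..<B}"
    then have "?W ^ c' = ?W ^ c * ?W * ?W ^ (c' - Suc c)"
      by (metis atLeastLessThan_iff power_Suc2 power_add le_add_diff_inverse)
    then show "?F c' * ?W ^ c' = ?W ^ c * (?W * (?F c' * ?W ^ (c' - Suc c)))" by (simp only: mult_ac)
  qed
  finally have "?W ^ c * (?F c + ?W * (\<Sum>c'\<in>{Suc c..<B}. ?F c' * ?W ^ (c' - Suc c))) = 0"
    by (simp only: distrib_left mult_ac)
  then have "?F c = ?W * - (\<Sum>c'\<in>{Suc c..<B}. ?F c' * ?W ^ (c' - Suc c))"
    by (simp add: eq_neg_iff_add_eq_0)
  then have "?W dvd ?F c" by (rule dvdI)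
  moreover have "?W = smult ((-1) ^ m) ([:-1, 1:] ^ m)"
    by (simp flip: smult_power)
  ultimately have "[:-1, 1:] ^ m dvd ?F c" by (simp add: smult_dvd_iff)
  from fewnomial_dvd_imp_zero[OF AB mB A this less.prems(1,2)] show ?case .
qed

text \<open>
  The operator \<open>x (1 - x) d/dx\<close> detects multiplicities at every point other than 0 and 1, and it maps
  \<open>f x\<^sup>u (1 - x)\<^sup>v\<close> to a polynomial of the same shape.
\<close>

definition euler_op :: "'a::idom poly \<Rightarrow> 'a poly" where
  "euler_op f = [:0, 1, -1:] * pderiv f"

definition twisted_euler_op :: "nat \<Rightarrow> nat \<Rightarrow> 'a::idom poly \<Rightarrow> 'a poly" where
  "twisted_euler_op u v f = euler_op f + [:of_nat u, - of_nat (u + v):] * f"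

lemma mult_pderiv_power: "q * pderiv (q ^ u) = smult (of_nat u) (pderiv q * q ^ u :: 'a::idom poly)"
proof (cases u)
  case (Suc k)
  then show ?thesis unfolding Suc pderiv_power_Suc by (simp add: mult_ac)
qed simp

text \<open>The linear factor in \<open>twisted_euler_op\<close> is \<open>x (1 - x)\<close> times
  the logarithmic derivative \<open>u / x - v / (1 - x)\<close> of
  \<open>x ^ u (1 - x) ^ v\<close>.\<close>

lemma euler_op_mult:
  "euler_op (f * ([:0, 1:] ^ u * [:1, -1:] ^ v)) =
     twisted_euler_op u v f * ([:0, 1:] ^ u * [:1, -1:] ^ v)"
proof -
  let ?x = "[:0, 1:] :: 'a poly" and ?y = "[:1, -1:] :: 'a poly"
  have xy: "[:0, 1, -1:] = ?x * ?y" by simp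
  have dx: "?x * pderiv (?x ^ u) = smult (of_nat u) (?x ^ u)"
    unfolding mult_pderiv_power by (simp add: pderiv_pCons)
  have dy: "?y * pderiv (?y ^ v) = smult (- of_nat v) (?y ^ v)"
    unfolding mult_pderiv_power by (simp add: pderiv_pCons)
  have "euler_op (f * (?x ^ u * ?y ^ v)) =
     euler_op f * (?x ^ u * ?y ^ v) + f * (?x * pderiv (?x ^ u) * ?y * ?y ^ v + ?x * ?x ^ u * (?y * pderiv (?y ^ v)))"
    unfolding euler_op_def pderiv_mult xy by (simp only: algebra_simps)
  also have "\<dots> = (euler_op f + (smult (of_nat u) ?y + smult (- of_nat v) ?x) * f) * (?x ^ u * ?y ^ v)"
    by (simp only: dx dy algebra_simps smult_add_right mult_smult_left mult_smult_right)
  also have "smult (of_nat u) ?y + smult (- of_nat v) ?x = [:of_nat u, - of_nat (u + v):]" by simp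
  finally show ?thesis by (simp add: twisted_euler_op_def)
qed

lemma euler_op_funpow_mult:
  "(euler_op ^^ n) (f * ([:0, 1:] ^ u * [:1, -1:] ^ v)) =
     (twisted_euler_op u v ^^ n) f * ([:0, 1:] ^ u * [:1, -1:] ^ v)"
  by (induction n) (simp_all only: funpow.simps o_def id_apply euler_op_mult)

lemma euler_op_funpow_sum: "(euler_op ^^ n) (\<Sum>i\<in>I. f i) = (\<Sum>i\<in>I. (euler_op ^^ n) (f i))"
proof (induction n)
  case (Suc n)
  have "euler_op (\<Sum>i\<in>I. g i) = (\<Sum>i\<in>I. euler_op (g i))" for g :: "'b \<Rightarrow> 'a poly"
    by (simp add: euler_op_def pderiv_sum sum_distrib_left)
  with Suc show ?case by simp
qed simp

lemma euler_op_funpow_smult: "(euler_op ^^ n) (smult a f) = smult a ((euler_op ^^ n) f)"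
proof (induction n)
  case (Suc n)
  have "euler_op (smult a g) = smult a (euler_op g)" for g :: "'a poly"
    by (simp only: euler_op_def pderiv_smult mult_smult_right)
  with Suc show ?case by simp
qed simp

lemma degree_twisted_euler_op_le: "degree (twisted_euler_op u v f) \<le> Suc (degree f)"
proof -
  have "degree (euler_op f) \<le> Suc (degree f)"
  proof (cases "degree f")
    case 0
    then show ?thesis by (auto simp: euler_op_def pderiv_eq_0_iff pderiv.simps elim!: degree_eq_zeroE)
  next
    case (Suc k)
    have "degree (euler_op f) \<le> degree [:0, 1, -1 :: 'a:] + degree (pderiv f)"
      unfolding euler_op_def by (rule degree_mult_le)
    also have "degree (pderiv f) \<le> degree f - 1" by (rule degree_le) (auto simp: coeff_pderiv coeff_eq_0)
    finally show ?thesis using Suc by simp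
  qed
  moreover have "degree ([:of_nat u, - of_nat (u + v):] * f) \<le> 1 + degree f"
    by (rule order.trans[OF degree_mult_le]) simp
  ultimately show ?thesis unfolding twisted_euler_op_def by (intro degree_add_le) auto
qed

lemma degree_twisted_euler_op_funpow_le: "degree ((twisted_euler_op u v ^^ n) f) \<le> degree f + n"
proof (induction n)
  case (Suc n)
  then show ?case using degree_twisted_euler_op_le[of u v "(twisted_euler_op u v ^^ n) f"] by simp
qed simp

lemma linear_power_dvd_cancel:
  fixes f g :: "'a::field poly"
  assumes "[:-s, 1:] ^ D dvd g * f" "poly g s \<noteq> 0"
  shows "[:-s, 1:] ^ D dvd f"
proof (cases "f = 0")
  case False
  moreover have "g \<noteq> 0" using assms(2) by auto
  ultimately have "order s (g * f) = order s f" using assms(2) by (simp add: order_mult order_0I)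
  then show ?thesis using assms(1) False \<open>g \<noteq> 0\<close> by (simp add: order_divides)
qed simp

text \<open>For \<open>f = (x - s) ^ D * h\<close> the derivative is
  \<open>D (x - s) ^ (D - 1) h\<close> modulo \<open>(x - s) ^ D\<close>. If it is divisible by
  \<open>(x - s) ^ D\<close>, another factor \<open>x - s\<close> must come from \<open>h\<close>,
  provided that \<open>D\<close> is nonzero in the field; this is the role of the
  characteristic.\<close>

lemma linear_power_dvd_if_euler_op_vanishes:
  fixes f :: "'a::field poly"
  assumes "\<And>n. n < D \<Longrightarrow> poly ((euler_op ^^ n) f) s = 0" "D \<le> CHAR('a)" "s \<noteq> 0" "s \<noteq> 1"
  shows "[:-s, 1:] ^ D dvd f"
  using assms(1,2)
proof (induction D arbitrary: f)
  case (Suc D)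
  have f: "[:-s, 1:] ^ D dvd f" using Suc.IH[of f] Suc.prems by simp
  show ?case
  proof (cases "D = 0")
    case True
    then show ?thesis using Suc.prems(1)[of 0] by (simp add: poly_eq_0_iff_dvd)
  next
    case False
    have "[:-s, 1:] ^ D dvd euler_op f"
      using Suc.IH[of "euler_op f"] Suc.prems(1)[of "Suc _"] Suc.prems(2) by (simp add: funpow_swap1)
    moreover have "poly [:0, 1, -1:] s \<noteq> 0"
      using assms(3,4) by (simp add: algebra_simps)
    ultimately have d: "[:-s, 1:] ^ D dvd pderiv f"
      unfolding euler_op_def by (rule linear_power_dvd_cancel)
    from f obtain h where h: "f = [:-s, 1:] ^ D * h" by (elim dvdE)
    obtain k where k: "D = Suc k" using False by (cases D) auto
    have d': "pderiv ([:-s, 1:] ^ D) = smult (of_nat D) ([:-s, 1:] ^ k)"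
      unfolding k pderiv_power_Suc by (simp add: pderiv_pCons)
    have "pderiv f = [:-s, 1:] ^ D * pderiv h + [:-s, 1:] ^ k * smult (of_nat D) h"
      unfolding h pderiv_mult d' by (simp only: mult_smult_left mult_smult_right mult.commute)
    with d have "[:-s, 1:] ^ D dvd [:-s, 1:] ^ k * smult (of_nat D) h"
      by (metis dvd_add_right_iff dvd_triv_left)
    then have "[:-s, 1:] dvd smult (of_nat D) h" unfolding k power_Suc2 by (simp only: dvd_mult_cancel_left) simp
    moreover have "(of_nat D :: 'a) \<noteq> 0"
      using Suc.prems(2) False by (auto simp: of_nat_eq_0_iff_char_dvd dest: dvd_imp_le)
    ultimately have "[:-s, 1:] dvd h" by (simp add: dvd_smult_iff)
    then show ?thesis unfolding h power_Suc2 by (rule mult_dvd_mono[OF dvd_refl])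
  qed
qed simp

text \<open>Pigeonhole principle: there are more vectors than possible values of the left-hand
  sides, and the difference of two vectors with equal values is a solution.\<close>

lemma homogeneous_linear_system:
  fixes M :: "'j \<Rightarrow> 'i \<Rightarrow> 'a::{finite, idom}"
  assumes "finite I" "finite J" "card J < card I"
  shows "\<exists>z. (\<exists>i\<in>I. z i \<noteq> 0) \<and> (\<forall>j\<in>J. (\<Sum>i\<in>I. z i * M j i) = 0)"
proof -
  define ev where "ev z = (\<lambda>j\<in>J. \<Sum>i\<in>I. z i * M j i)" for z
  have gt1: "1 < CARD('a)"
    using card_mono[of "UNIV :: 'a set" "{0, 1}"] by simp
  have "card (J \<rightarrow>\<^sub>E (UNIV :: 'a set)) < card (I \<rightarrow>\<^sub>E (UNIV :: 'a set))"
    using assms gt1 by (simp add: card_PiE power_strict_increasing)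
  moreover have "ev ` (I \<rightarrow>\<^sub>E UNIV) \<subseteq> J \<rightarrow>\<^sub>E UNIV" by (auto simp: ev_def)
  ultimately have "\<not> inj_on ev (I \<rightarrow>\<^sub>E UNIV)"
    using assms(2) by (metis card_inj_on_le finite finite_PiE linorder_not_le)
  then obtain z w where zw: "z \<in> I \<rightarrow>\<^sub>E UNIV" "w \<in> I \<rightarrow>\<^sub>E UNIV" "ev z = ev w" "z \<noteq> w"
    by (auto simp: inj_on_def)
  show ?thesis
  proof (intro exI[of _ "\<lambda>i. z i - w i"] conjI ballI)
    show "\<exists>i\<in>I. z i - w i \<noteq> 0" using zw PiE_ext[of z I _ w] by fastforce
    show "(\<Sum>i\<in>I. (z i - w i) * M j i) = 0" if "j \<in> J" for j
      using fun_cong[OF zw(3), of j] that by (simp add: ev_def algebra_simps sum_subtractf)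
  qed
qed

section \<open>Stepanov's method\<close>

definition power_fibre :: "nat \<Rightarrow> 'a::field \<Rightarrow> 'a \<Rightarrow> 'a set" where
  "power_fibre m c d = {x. x ^ m = c \<and> (1 - x) ^ m = d}"

lemma sum_order_le_degree:
  fixes f :: "'a::field poly"
  assumes "f \<noteq> 0" "finite S" "\<And>x. x \<in> S \<Longrightarrow> [:-x, 1:] ^ A dvd f"
  shows "A * card S \<le> degree f"
proof -
  have "A * card S = (\<Sum>x\<in>S. A)" by simp
  also have "\<dots> \<le> (\<Sum>x\<in>S. order x f)"
    using assms by (intro sum_mono) (simp add: order_divides)
  also have "\<dots> = (\<Sum>x\<in>S. count (proots f) x)" using assms(1) by simp
  also have "\<dots> \<le> size (proots f)"
  proof -
    have "(\<Sum>x\<in>S. count (proots f) x) = (\<Sum>x\<in>S \<inter> set_mset (proots f). count (proots f) x)"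
      using assms(2) by (intro sum.mono_neutral_right) (auto simp: not_in_iff simp del: count_proots set_count_proots)
    also have "\<dots> \<le> size (proots f)"
      unfolding size_multiset_overloaded_eq by (intro sum_mono2) auto
    finally show ?thesis .
  qed
  also have "\<dots> \<le> degree f" by (rule size_proots_le)
  finally show ?thesis .
qed

text \<open>
  The auxiliary polynomial is a combination of the products \<open>x\<^sup>a (x\<^sup>m)\<^sup>b ((1 - x)\<^sup>m)\<^sup>c\<close>. On a fibre,
  \<open>x\<^sup>m\<close> and \<open>(1 - x)\<^sup>m\<close> are constant, so vanishing to order \<open>A\<close> on a whole fibre costs
  only about \<open>2 A\<^sup>2\<close> linear conditions, however many points the fibre has.
\<close>

lemma stepanov_power_fibre_bound:
  fixes T :: "('a::{finite, field} \<times> 'a) set"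
  assumes nz: "\<And>c d. (c, d) \<in> T \<Longrightarrow> c \<noteq> 0 \<and> d \<noteq> 0"
    and A: "1 \<le> A" and TA: "16 * card T * A ^ 3 \<le> m\<^sup>2" and Ap: "m\<^sup>2 \<le> A * CHAR('a)"
  shows "A\<^sup>2 * (\<Sum>(c, d)\<in>T. card (power_fibre m c d)) \<le> 3 * m\<^sup>2"
proof (cases "T = {}")
  case False
  \<comment> \<open>The largest \<open>B\<close> with \<open>A * B \<le> m\<close>, as independence
    requires. Rounding loses less than a factor 2, so \<open>2 * A * B > m\<close>, which leaves
    more unknowns than equations.\<close>
  define B where "B = m div A"
  have k: "1 \<le> card T" using False by (simp add: Suc_le_eq card_gt_0_iff)
  have "A ^ 3 \<le> m\<^sup>2" using k TA by (metis le_trans mult_le_mono1 mult_1 one_le_numeral mult_le_mono)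
  have m: "0 < m" using \<open>A ^ 3 \<le> m\<^sup>2\<close> A by (cases m) auto
  have Am: "A \<le> m"
  proof (rule ccontr)
    assume "\<not> A \<le> m"
    then have "m\<^sup>2 < A\<^sup>2" by (simp add: power_strict_mono)
    also have "A\<^sup>2 \<le> A ^ 3" using A by (simp add: power_increasing)
    finally show False using \<open>A ^ 3 \<le> m\<^sup>2\<close> by simp
  qed
  have AB: "A * B \<le> m" by (simp add: B_def)
  have B: "1 \<le> B" using Am A by (simp add: B_def Suc_le_eq div_greater_zero_iff)
  have "A * (m * B) = m * (A * B)" by simp
  also have "\<dots> \<le> m * m" using AB by (rule mult_le_mono2)
  also have "\<dots> \<le> A * CHAR('a)" using Ap by (simp add: power2_eq_square)
  finally have mB: "m * B \<le> CHAR('a)" using A by simp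
  have "m * 1 \<le> m * B" using B by (intro mult_le_mono2)
  then have AC: "A \<le> CHAR('a)" using Am mB by linarith
  have "m < A * (B + 1)" using A by (simp add: B_def dividend_less_times_div)
  also have "\<dots> \<le> 2 * A * B" using B by simp
  finally have "m\<^sup>2 < (2 * A * B)\<^sup>2" by (simp add: power_strict_mono)
  also have "(2 * A * B)\<^sup>2 = A\<^sup>2 * (4 * B\<^sup>2)" by (simp add: power_mult_distrib)
  finally have "16 * card T * A ^ 3 < A\<^sup>2 * (4 * B\<^sup>2)" using TA by linarith
  also have "16 * card T * A ^ 3 = A\<^sup>2 * (16 * card T * A)"
    by (simp add: power2_eq_square power3_eq_cube)
  finally have "16 * card T * A < 4 * B\<^sup>2" using A by (simp only: nat_mult_less_cancel_disj)
  then have kAB: "2 * card T * A < B\<^sup>2" unfolding mult.assoc by linarith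

  define I where "I = {..<A} \<times> {..<B} \<times> {..<B}"
  \<comment> \<open>One equation for each fibre, each order below \<open>A\<close> and each
    coefficient of a polynomial of degree below \<open>2 * A\<close>: in all
    \<open>2 * card T * A ^ 2\<close> equations against \<open>A * B ^ 2\<close> unknowns.\<close>
  define J where "J = T \<times> {..<A} \<times> {..<2 * A}"
  define R where "R n a b c = (twisted_euler_op (m * b) (m * c) ^^ n) (monom 1 a :: 'a poly)" for n a b c
  define M where "M = (\<lambda>((c, d), n, e) (a, b, b'). c ^ b * d ^ b' * coeff (R n a b b') e)"
  have "card J = A * (2 * card T * A)" by (simp add: J_def card_cartesian_product)
  also have "\<dots> < A * B\<^sup>2" using kAB A by simp
  also have "\<dots> = card I" by (simp add: I_def card_cartesian_product power2_eq_square)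
  finally have JI: "card J < card I" .
  have fin: "finite I" "finite J" by (simp_all add: I_def J_def)
  obtain z where z: "\<exists>i\<in>I. z i \<noteq> 0" "\<And>j. j \<in> J \<Longrightarrow> (\<Sum>i\<in>I. z i * M j i) = 0"
    using homogeneous_linear_system[OF fin JI, of M] by blast

  define P where "P = (\<Sum>(a, b, c)\<in>I. smult (z (a, b, c)) (monom 1 a * ([:0, 1:] ^ (m * b) * [:1, -1:] ^ (m * c))))"
  have mon: "smult w (monom 1 a * ([:0, 1:] ^ (m * b) * [:1, -1:] ^ (m * c)))
      = monom w (a + m * b) * ([:1, -1:] ^ m) ^ c" for w :: 'a and a b c
  proof -
    have "[:0, 1 :: 'a:] ^ (m * b) = monom 1 (m * b)" by (simp add: monom_altdef)
    then show ?thesis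
      by (simp only: power_mult[of "[:1, -1:]"] mult.assoc[symmetric] mult_monom mult_smult_left[symmetric] smult_monom mult_1_right)
  qed
  have "P \<noteq> 0"
  proof
    assume "P = 0"
    have "P = (\<Sum>a<A. \<Sum>b<B. \<Sum>c<B. monom (z (a, b, c)) (a + m * b) * ([:1, -1:] ^ m) ^ c)"
      unfolding P_def I_def mon by (simp add: sum.cartesian_product)
    also have "\<dots> = (\<Sum>a<A. \<Sum>c<B. \<Sum>b<B. monom (z (a, b, c)) (a + m * b) * ([:1, -1:] ^ m) ^ c)"
      by (intro sum.cong refl sum.swap)
    also have "\<dots> = (\<Sum>c<B. \<Sum>a<A. \<Sum>b<B. monom (z (a, b, c)) (a + m * b) * ([:1, -1:] ^ m) ^ c)"
      by (rule sum.swap)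
    also have "\<dots> = (\<Sum>c<B. (\<Sum>a<A. \<Sum>b<B. monom (z (a, b, c)) (a + m * b)) * ([:1, -1:] ^ m) ^ c)"
      by (simp add: sum_distrib_right)
    finally have "(\<Sum>c<B. (\<Sum>a<A. \<Sum>b<B. monom (z (a, b, c)) (a + m * b)) * ([:1, -1:] ^ m) ^ c) = 0"
      using \<open>P = 0\<close> by simp
    from power_product_polys_independent[OF AB mB Am this] z(1) show False
      by (auto simp: I_def)
  qed

  have degR: "degree (R n a b c) < 2 * A" if "n < A" "a < A" for n a b c
    using degree_twisted_euler_op_funpow_le[where n = n and u = "m * b" and v = "m * c" and f = "monom 1 a :: 'a poly"] that
    by (simp add: R_def degree_monom_eq)
  have van: "[:-x, 1:] ^ A dvd P" if cd: "(c, d) \<in> T" and x: "x \<in> power_fibre m c d" for c d x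
  proof (rule linear_power_dvd_if_euler_op_vanishes)
    have xm: "x ^ m = c" "(1 - x) ^ m = d" using x by (auto simp: power_fibre_def)
    show "A \<le> CHAR('a)" by (rule AC)
    show "x \<noteq> 0" "x \<noteq> 1" using xm nz[OF cd] m by auto
    fix n assume n: "n < A"
    \<comment> \<open>On the fibre the \<open>n\<close>-th iterate of the operator on
      \<open>P\<close> takes the values of \<open>Q\<close>. The system makes \<open>Q\<close>
      vanish identically, so no condition refers to individual points.\<close>
    define Q where "Q = (\<Sum>(a, b, b')\<in>I. smult (z (a, b, b') * (c ^ b * d ^ b')) (R n a b b'))"
    have "coeff Q e = 0" for e
    proof (cases "e < 2 * A")
      case True
      then have "((c, d), n, e) \<in> J" using cd n by (simp add: J_def)
      from z(2)[OF this] show ?thesis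
        by (simp add: Q_def M_def coeff_sum split_def mult.assoc)
    next
      case False
      have "coeff (R n a b b') e = 0" if "a < A" for a b b'
        using degR[OF n that, of b b'] False by (simp add: coeff_eq_0)
      then show ?thesis by (auto simp: Q_def coeff_sum I_def split_def intro!: sum.neutral)
    qed
    then have "Q = 0" by (simp add: poly_eq_iff)
    have "(euler_op ^^ n) P = (\<Sum>(a, b, b')\<in>I. smult (z (a, b, b')) (R n a b b' * ([:0, 1:] ^ (m * b) * [:1, -1:] ^ (m * b'))))"
      unfolding P_def euler_op_funpow_sum split_def euler_op_funpow_smult euler_op_funpow_mult R_def ..
    then have "poly ((euler_op ^^ n) P) x = (\<Sum>(a, b, b')\<in>I. z (a, b, b') * (poly (R n a b b') x * (c ^ b * d ^ b')))"
      by (simp add: poly_sum split_def power_mult xm)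
    also have "\<dots> = poly Q x"
      by (simp add: Q_def poly_sum split_def mult_ac)
    finally show "poly ((euler_op ^^ n) P) x = 0" using \<open>Q = 0\<close> by simp
  qed

  define S where "S = (\<Union>(c, d)\<in>T. power_fibre m c d)"
  have "A * card S \<le> degree P"
    using \<open>P \<noteq> 0\<close> by (rule sum_order_le_degree) (auto simp: S_def van)
  also have "degree P \<le> A + 2 * (m * B)"
    unfolding P_def
  proof (rule degree_sum_le)
    fix i assume "i \<in> I"
    then obtain a b c where i: "i = (a, b, c)" "a < A" "b < B" "c < B" by (auto simp: I_def)
    have "degree ([:1, -1 :: 'a:] ^ (m * c)) = m * c" by (simp add: degree_power_eq)
    moreover have "degree ([:0, 1 :: 'a:] ^ (m * b)) = m * b" by (simp add: degree_power_eq)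
    ultimately have "degree ([:0, 1 :: 'a:] ^ (m * b) * [:1, -1:] ^ (m * c)) \<le> m * b + m * c"
      using degree_mult_le[of "[:0, 1 :: 'a:] ^ (m * b)" "[:1, -1:] ^ (m * c)"] by simp
    then have "degree (monom 1 a * ([:0, 1 :: 'a:] ^ (m * b) * [:1, -1:] ^ (m * c))) \<le> a + (m * b + m * c)"
      using degree_mult_le[of "monom 1 a" "[:0, 1 :: 'a:] ^ (m * b) * [:1, -1:] ^ (m * c)"]
      by (simp add: degree_monom_eq)
    also have "\<dots> \<le> A + (m * B + m * B)"
      using i by (intro add_mono mult_le_mono2) auto
    finally show "degree (case i of (a, b, c) \<Rightarrow> smult (z (a, b, c)) (monom 1 a * ([:0, 1:] ^ (m * b) * [:1, -1:] ^ (m * c)))) \<le> A + 2 * (m * B)"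
      by (simp add: i)
  qed (simp add: I_def)
  finally have "A * (A * card S) \<le> A * (A + 2 * (m * B))" by (rule mult_le_mono2)
  also have "\<dots> = A * A + 2 * m * (A * B)" by (simp add: algebra_simps)
  also have "\<dots> \<le> m * m + 2 * m * m" using Am AB by (intro add_mono mult_mono) auto
  finally have "A\<^sup>2 * card S \<le> 3 * m\<^sup>2" by (simp add: power2_eq_square)
  moreover have "card S = (\<Sum>(c, d)\<in>T. card (power_fibre m c d))"
    unfolding S_def by (subst card_UN_disjoint) (auto simp: power_fibre_def split_def)
  ultimately show ?thesis by simp
qed simp

section \<open>Counting fibres with many points\<close>

definition rich_fibres :: "nat \<Rightarrow> nat \<Rightarrow> ('a::field \<times> 'a) set" where
  "rich_fibres m s = {(c, d). c \<noteq> 0 \<and> d \<noteq> 0 \<and> s \<le> card (power_fibre m c d)}"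

text \<open>Stated for subsets because the rich fibres together may be too many for the hypothesis
  on \<open>card T * A ^ 3\<close>; a smaller family is chosen in that case.\<close>

lemma card_rich_subset_bound:
  fixes T :: "('a::{finite, field} \<times> 'a) set"
  assumes "T \<subseteq> rich_fibres m s" "1 \<le> A" "16 * card T * A ^ 3 \<le> m\<^sup>2" "m\<^sup>2 \<le> A * CHAR('a)"
  shows "A\<^sup>2 * (card T * s) \<le> 3 * m\<^sup>2"
proof -
  have "card T * s = (\<Sum>(c, d)\<in>T. s)" by simp
  also have "\<dots> \<le> (\<Sum>(c, d)\<in>T. card (power_fibre m c d))"
    using assms(1) by (intro sum_mono) (auto simp: rich_fibres_def)
  finally have "A\<^sup>2 * (card T * s) \<le> A\<^sup>2 * (\<Sum>(c, d)\<in>T. card (power_fibre m c d))" by (rule mult_le_mono2)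
  also have "\<dots> \<le> 3 * m\<^sup>2"
    using assms by (intro stepanov_power_fibre_bound) (auto simp: rich_fibres_def)
  finally show ?thesis .
qed

text \<open>With \<open>A\<close> as large as \<open>16 * g * A ^ 3 \<le> m\<^sup>2\<close> permits,
  \<open>A ^ 3\<close> is about \<open>m\<^sup>2 / g\<close>, and
  \<open>A\<^sup>2 * g * s \<le> 3 * m\<^sup>2\<close> turns into a bound for
  \<open>g * s ^ 3\<close>. Since \<open>A\<close> may not fall below \<open>A0\<close>, the
  richness \<open>s\<close> has to be a large multiple of \<open>A0\<close>.\<close>

lemma card_rich_fibres_le:
  assumes A0: "1 \<le> A0" "m\<^sup>2 \<le> A0 * CHAR('a)" "16 * A0 ^ 3 \<le> m\<^sup>2" and s: "97 * A0 \<le> s"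
  shows "card (rich_fibres m s :: ('a::{finite, field} \<times> 'a) set) * s ^ 3 \<le> 442368 * m\<^sup>2"
proof -
  let ?G = "rich_fibres m s :: ('a \<times> 'a) set"
  define g where "g = card ?G"
  have m: "0 < m" using A0(1,3) by (cases m) auto
  consider "g = 0" | "1 \<le> g" "16 * g * A0 ^ 3 \<le> m\<^sup>2" | "m\<^sup>2 < 16 * g * A0 ^ 3" by linarith
  then have "g * s ^ 3 \<le> 442368 * m\<^sup>2"
  proof cases
    case 2
    define P where "P A \<longleftrightarrow> 16 * g * A ^ 3 \<le> m\<^sup>2" for A
    define A where "A = (GREATEST A. P A)"
    have bound: "A \<le> m\<^sup>2" if "P A" for A
    proof -
      have "A \<le> A ^ 3" by (cases "A = 0") (simp_all add: self_le_power)
      also have "\<dots> \<le> 16 * g * A ^ 3" using 2(1) by simp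
      finally show ?thesis using that by (simp add: P_def)
    qed
    have PA: "P A" unfolding A_def using 2(2) bound by (intro GreatestI_nat[of P A0 "m\<^sup>2"]) (auto simp: P_def)
    have "A0 \<le> A" unfolding A_def using 2(2) bound by (intro Greatest_le_nat[of P A0 "m\<^sup>2"]) (auto simp: P_def)
    have "\<not> P (A + 1)"
      using Greatest_le_nat[of P "A + 1" "m\<^sup>2"] bound by (auto simp: A_def)
    then have "m\<^sup>2 \<le> 16 * g * (A + 1) ^ 3" by (simp add: P_def)
    also have "(A + 1) ^ 3 \<le> (2 * A) ^ 3" using A0(1) \<open>A0 \<le> A\<close> by (intro power_mono) auto
    finally have low: "m\<^sup>2 \<le> 128 * (g * A ^ 3)" by (simp add: power_mult_distrib)
    have "m\<^sup>2 \<le> A * CHAR('a)" using A0(2) \<open>A0 \<le> A\<close> by (meson le_trans mult_le_mono1)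
    then have up: "A\<^sup>2 * (g * s) \<le> 3 * m\<^sup>2"
      unfolding g_def using PA A0(1) \<open>A0 \<le> A\<close>
      by (intro card_rich_subset_bound) (auto simp: P_def g_def)
    \<comment> \<open>Squaring \<open>low\<close> and cubing \<open>up\<close> eliminates
      \<open>A\<close>; \<open>442368 = 128 ^ 2 * 3 ^ 3\<close>.\<close>
    have "(m\<^sup>2)\<^sup>2 * (g * s ^ 3) \<le> (128 * (g * A ^ 3))\<^sup>2 * (g * s ^ 3)"
      using low by (intro mult_le_mono1 power_mono) auto
    also have "\<dots> = 16384 * (A\<^sup>2 * (g * s)) ^ 3"
      by (simp add: power_mult_distrib power2_eq_square power3_eq_cube)
    also have "\<dots> \<le> 16384 * (3 * m\<^sup>2) ^ 3" using up by (intro mult_le_mono2 power_mono) auto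
    also have "\<dots> = (m\<^sup>2)\<^sup>2 * (442368 * m\<^sup>2)" by (simp add: power_mult_distrib power2_eq_square power3_eq_cube)
    finally show ?thesis using m by simp
  next
    case 3
    \<comment> \<open>This case is contradictory: a subfamily of the largest size admissible for
      \<open>A0\<close> already forces \<open>s < 96 * A0\<close>. Hence the factor 97 in the
      hypothesis.\<close>
    define k where "k = m\<^sup>2 div (16 * A0 ^ 3)"
    have pos: "0 < 16 * A0 ^ 3" using A0(1) by simp
    have k1: "1 \<le> k" unfolding k_def using A0(3) pos by (simp add: Suc_le_eq div_greater_zero_iff)
    have k2: "16 * A0 ^ 3 * k \<le> m\<^sup>2" unfolding k_def by (rule times_div_less_eq_dividend)
    have "m\<^sup>2 < 16 * A0 ^ 3 * (k + 1)" unfolding k_def using dividend_less_times_div[OF pos] by simp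
    also have "\<dots> \<le> 16 * A0 ^ 3 * (2 * k)" using k1 by (intro mult_le_mono2) simp
    finally have k3: "m\<^sup>2 < 32 * A0 ^ 3 * k" by simp
    have "16 * A0 ^ 3 * k < 16 * A0 ^ 3 * g" using k2 3 mult.assoc[of 16 g "A0 ^ 3"] mult.assoc[of 16 "A0 ^ 3" g] mult.commute[of g "A0 ^ 3"] by linarith
    then have "k \<le> card ?G" using pos by (simp add: g_def)
    then obtain T where T: "T \<subseteq> ?G" "card T = k" by (metis obtain_subset_with_card_n)
    have "A0\<^sup>2 * (k * s) \<le> 3 * m\<^sup>2"
      using card_rich_subset_bound[OF T(1) A0(1)] k2 A0(2) T(2) by (simp add: mult_ac)
    also have "\<dots> < 3 * (32 * A0 ^ 3 * k)" using k3 by linarith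
    also have "\<dots> = A0\<^sup>2 * (k * (96 * A0))" by (simp add: power2_eq_square power3_eq_cube)
    finally have "s < 96 * A0" using k1 A0(1) by simp
    with s A0(1) show ?thesis by simp
  qed simp
  then show ?thesis by (simp add: g_def)
qed

lemma card_nth_roots_le:
  assumes "0 < m"
  shows "card {x :: 'a::{finite, field}. x ^ m = c} \<le> m"
proof -
  let ?p = "monom 1 m + [:- c:]"
  have deg: "degree ?p = m"
    using assms by (subst degree_add_eq_left) (simp_all add: degree_monom_eq)
  then have "?p \<noteq> 0" using assms by auto
  then have "card {x. poly ?p x = 0} \<le> m" using card_poly_roots_bound[of ?p] deg by simp
  then show ?thesis by (simp add: poly_monom)
qed

lemma card_power_fibre_le:
  assumes "0 < m"
  shows "card (power_fibre m c d :: 'a::{finite, field} set) \<le> m"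
  by (rule order.trans[OF card_mono card_nth_roots_le[OF assms, of c]]) (auto simp: power_fibre_def)

lemma sum_inverse_le_ln: "0 < n \<Longrightarrow> (\<Sum>s = 1..n. 1 / real s) \<le> 1 + ln (real n)"
proof (induction n)
  case (Suc n)
  show ?case
  proof (cases "n = 0")
    case False
    then have "1 / real (Suc n) \<le> ln (real (Suc n)) - ln (real n)"
      using ln_diff_le[of "real n" "real (Suc n)"] by simp
    with Suc.IH False show ?thesis by simp
  qed simp
qed simp

lemma cube_le_sum_squares: "n ^ 3 \<le> (\<Sum>s = 1..n. 3 * s\<^sup>2)" for n :: nat
proof (induction n)
  case (Suc n)
  have "Suc n ^ 3 \<le> n ^ 3 + 3 * (Suc n)\<^sup>2" by (simp add: power2_eq_square power3_eq_cube algebra_simps)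
  with Suc show ?case by simp
qed simp

text \<open>Summation by levels: a cube is at most the sum of \<open>3 * s\<^sup>2\<close> over the
  levels \<open>s\<close> below it, and \<open>O(m\<^sup>2 / s ^ 3)\<close> fibres reach level
  \<open>s\<close>. What remains is a harmonic sum, the source of the logarithm.\<close>

lemma sum_rich_fibre_cubes_le:
  assumes A0: "1 \<le> A0" "m\<^sup>2 \<le> A0 * CHAR('a)" "16 * A0 ^ 3 \<le> m\<^sup>2"
  shows "real (\<Sum>(c, d)\<in>(rich_fibres m (97 * A0) :: ('a::{finite, field} \<times> 'a) set). card (power_fibre m c d) ^ 3)
    \<le> 1327104 * (real m)\<^sup>2 * (1 + ln (real m))"
proof -
  let ?s0 = "97 * A0"
  let ?G = "rich_fibres m ?s0 :: ('a \<times> 'a) set"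
  let ?n = "\<lambda>x :: 'a \<times> 'a. card (power_fibre m (fst x) (snd x))"
  have m: "0 < m" using A0(1,3) by (cases m) auto
  have nm: "?n x \<le> m" for x by (rule card_power_fibre_le[OF m])
  have "(\<Sum>x\<in>?G. ?n x ^ 3) \<le> (\<Sum>x\<in>?G. \<Sum>s = 1..m. if s \<le> ?n x then 3 * s\<^sup>2 else 0)"
  proof (rule sum_mono)
    fix x
    have "?n x ^ 3 \<le> (\<Sum>s = 1..?n x. 3 * s\<^sup>2)" by (rule cube_le_sum_squares)
    also have "\<dots> = (\<Sum>s \<in> {s \<in> {1..m}. s \<le> ?n x}. 3 * s\<^sup>2)"
      using nm[of x] by (intro sum.cong) auto
    also have "\<dots> = (\<Sum>s = 1..m. if s \<le> ?n x then 3 * s\<^sup>2 else 0)"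
      by (rule sum.inter_filter) simp
    finally show "?n x ^ 3 \<le> (\<Sum>s = 1..m. if s \<le> ?n x then 3 * s\<^sup>2 else 0)" .
  qed
  also have "\<dots> = (\<Sum>s = 1..m. 3 * s\<^sup>2 * card {x \<in> ?G. s \<le> ?n x})"
    by (subst sum.swap) (simp add: sum.inter_filter[symmetric] mult.commute)
  finally have "real (\<Sum>x\<in>?G. ?n x ^ 3) \<le> (\<Sum>s = 1..m. real (3 * s\<^sup>2 * card {x \<in> ?G. s \<le> ?n x}))"
    by (simp only: of_nat_le_iff flip: of_nat_sum)
  also have "\<dots> \<le> (\<Sum>s = 1..m. 1327104 * (real m)\<^sup>2 * (1 / real s))"
  proof (rule sum_mono)
    fix s assume s: "s \<in> {1..m}"
    \<comment> \<open>Below the threshold every element of \<open>?G\<close> reaches level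
      \<open>s\<close>; passing to the maximum makes the count applicable and only enlarges the
      cube.\<close>
    let ?t = "max s ?s0"
    have "{x \<in> ?G. s \<le> ?n x} = rich_fibres m ?t" by (auto simp: rich_fibres_def)
    then have "card {x \<in> ?G. s \<le> ?n x} * s ^ 3 \<le> card (rich_fibres m ?t :: ('a \<times> 'a) set) * ?t ^ 3"
      by (intro mult_le_mono power_mono) auto
    also have "\<dots> \<le> 442368 * m\<^sup>2" by (rule card_rich_fibres_le[OF A0]) simp
    finally have "real (card {x \<in> ?G. s \<le> ?n x} * s ^ 3) \<le> real (442368 * m\<^sup>2)" by (simp only: of_nat_le_iff)
    then show "real (3 * s\<^sup>2 * card {x \<in> ?G. s \<le> ?n x}) \<le> 1327104 * (real m)\<^sup>2 * (1 / real s)"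
      using s by (simp add: field_simps power2_eq_square power3_eq_cube)
  qed
  also have "\<dots> = 1327104 * (real m)\<^sup>2 * (\<Sum>s = 1..m. 1 / real s)" by (rule sum_distrib_left[symmetric])
  also have "\<dots> \<le> 1327104 * (real m)\<^sup>2 * (1 + ln (real m))"
    using sum_inverse_le_ln[OF m] by (intro mult_left_mono) auto
  finally show ?thesis by (simp add: split_def)
qed

section \<open>Sums over roots of unity and collinear triples\<close>

definition unity_roots :: "nat \<Rightarrow> 'a::field set" where
  "unity_roots m = {x. x ^ m = 1}"

lemma unity_roots_mult: "x \<in> unity_roots m \<Longrightarrow> y \<in> unity_roots m \<Longrightarrow> x * y \<in> unity_roots m"
  by (simp add: unity_roots_def power_mult_distrib)

lemma unity_roots_divide: "x \<in> unity_roots m \<Longrightarrow> y \<in> unity_roots m \<Longrightarrow> x / y \<in> unity_roots m"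
  by (simp add: unity_roots_def power_divide)

lemma unity_roots_nonzero: "x \<in> unity_roots m \<Longrightarrow> 0 < m \<Longrightarrow> x \<noteq> 0"
  by (auto simp: unity_roots_def power_0_left)

text \<open>The vanishing determinant, with its terms sorted by sign. The three products on either
  side multiply to \<open>a1 * a2 * a3 * b1 * b2 * b3\<close>, so they form two triples with equal
  sum and equal product. Coinciding points are allowed.\<close>

definition collinear_triples :: "nat \<Rightarrow> (('a::field \<times> 'a) \<times> ('a \<times> 'a) \<times> ('a \<times> 'a)) set" where
  "collinear_triples m = {((a1, b1), (a2, b2), (a3, b3)).
     {a1, a2, a3, b1, b2, b3} \<subseteq> unity_roots m \<and>
     a2 * b3 + a3 * b1 + a1 * b2 = a1 * b3 + a2 * b1 + a3 * b2}"

definition sum_product_pairs :: "nat \<Rightarrow> (('a::field \<times> 'a \<times> 'a) \<times> ('a \<times> 'a \<times> 'a)) set" where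
  "sum_product_pairs m = {((u1, u2, u3), (v1, v2, v3)).
     {u1, u2, u3, v1, v2, v3} \<subseteq> unity_roots m \<and>
     u1 + u2 + u3 = v1 + v2 + v3 \<and> u1 * u2 * u3 = v1 * v2 * v3}"

text \<open>\<open>G\<close> reads the six products off the determinant. Its section
  \<open>F\<close> prescribes \<open>a1 = w\<close> and solves in turn for \<open>b2\<close>,
  \<open>b3\<close>, \<open>a2\<close>, \<open>b1\<close>, \<open>a3\<close>; the last equation
  \<open>a3 * b2 = v3\<close> is the equality of the products. The free choice of \<open>w\<close>
  gives the factor \<open>m\<close>.\<close>

lemma sum_product_pairs_le_collinear_triples:
  assumes "0 < m" "card (unity_roots m :: 'a::{finite, field} set) = m"
  shows "m * card (sum_product_pairs m :: (('a \<times> 'a \<times> 'a) \<times> _) set) \<le> card (collinear_triples m :: (('a \<times> 'a) \<times> _) set)"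
proof -
  define F where "F = (\<lambda>(w :: 'a, (u1 :: 'a, u2 :: 'a, u3 :: 'a), (v1 :: 'a, v2 :: 'a, v3 :: 'a)).
    ((w, v2 * v1 / (u1 * w :: 'a)), (u1 * w / v1, u3 / w), (u2 * u1 * w / (v1 * v2), v1 / w)))"
  define G where "G = (\<lambda>((a1 :: 'a, b1), (a2, b2), (a3, b3)).
    (a1, (a2 * b3, a3 * b1, a1 * b2), (a1 * b3, a2 * b1, a3 * b2)))"
  let ?X = "unity_roots m \<times> sum_product_pairs m :: ('a \<times> ('a \<times> 'a \<times> 'a) \<times> _) set"
  have GF: "G (F x) = x" if "x \<in> ?X" for x
  proof -
    obtain w u1 u2 u3 v1 v2 v3 where x: "x = (w, (u1, u2, u3), (v1, v2, v3))" by (cases x) auto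
    with that assms(1) have "w \<noteq> 0" "u1 \<noteq> 0" "v1 \<noteq> 0" "v2 \<noteq> 0" "u1 * u2 * u3 = v1 * v2 * v3"
      by (auto simp: sum_product_pairs_def dest: unity_roots_nonzero)
    then show ?thesis unfolding x F_def G_def by (simp add: field_simps)
  qed
  have "F x \<in> collinear_triples m" if "x \<in> ?X" for x
  proof -
    have "G (F x) = x" by (rule GF[OF that])
    moreover obtain a1 b1 a2 b2 a3 b3 where F: "F x = ((a1, b1), (a2, b2), (a3, b3))"
      by (cases "F x") auto
    moreover have "{a1, a2, a3, b1, b2, b3} \<subseteq> unity_roots m"
      using that F by (auto simp: F_def sum_product_pairs_def intro!: unity_roots_mult unity_roots_divide)
    ultimately show ?thesis
      using that by (auto simp: G_def sum_product_pairs_def collinear_triples_def)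
  qed
  then have "card ?X \<le> card (collinear_triples m :: (('a \<times> 'a) \<times> _) set)"
    using GF by (intro card_inj_on_le[where f = F] inj_on_inverseI[where g = G]) auto
  then show ?thesis by (simp add: card_cartesian_product assms(2))
qed

section \<open>Additive characters of a finite field\<close>

locale additive_character =
  fixes psi :: "'a::{finite, field} \<Rightarrow> complex"
  assumes psi_add: "psi (x + y) = psi x * psi y"
    and norm_psi: "norm (psi x) = 1"
    and sum_psi: "(\<Sum>x\<in>UNIV. psi x) = 0"
begin

lemma psi_nonzero: "psi x \<noteq> 0"
  using norm_psi[of x] by auto

lemma psi_0: "psi 0 = 1"
  using psi_add[of 0 0] psi_nonzero[of 0] by simp

lemma psi_diff: "psi (x - y) = psi x * cnj (psi y)"
proof -
  have "psi y * cnj (psi y) = 1" using complex_norm_square[of "psi y"] by (simp add: norm_psi)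
  then show ?thesis using psi_add[of "x - y" y] by (simp add: mult.assoc)
qed

lemma sum_psi_mult: "(\<Sum>b\<in>UNIV. psi (b * y)) = (if y = 0 then of_nat CARD('a) else 0)"
proof (cases "y = 0")
  case False
  then have "bij (\<lambda>b. b * y)"
    by (intro bijI injI) (auto intro!: surjI[where f = "\<lambda>x. x / y"])
  then have "(\<Sum>b\<in>UNIV. psi (b * y)) = (\<Sum>x\<in>UNIV. psi x)"
    by (rule sum.reindex_bij_betw)
  with False sum_psi show ?thesis by simp
qed (simp add: psi_0)

lemma parseval:
  assumes "finite I"
  shows "(\<Sum>b\<in>UNIV. (norm (\<Sum>i\<in>I. psi (b * f i)))\<^sup>2)
    = real CARD('a) * real (card {(i, j). i \<in> I \<and> j \<in> I \<and> f i = f j})"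
proof -
  have "complex_of_real (\<Sum>b\<in>UNIV. (norm (\<Sum>i\<in>I. psi (b * f i)))\<^sup>2)
      = (\<Sum>b\<in>UNIV. \<Sum>(i, j)\<in>I \<times> I. psi (b * (f i - f j)))"
    unfolding of_real_sum complex_norm_square
    by (intro sum.cong refl)
      (simp add: cnj_sum sum_product sum.cartesian_product right_diff_distrib psi_diff)
  also have "\<dots> = (\<Sum>(i, j)\<in>I \<times> I. \<Sum>b\<in>UNIV. psi (b * (f i - f j)))"
    unfolding split_def by (rule sum.swap)
  also have "\<dots> = (\<Sum>(i, j)\<in>I \<times> I. if f i = f j then of_nat CARD('a) else 0)"
    by (simp add: sum_psi_mult)
  also have "\<dots> = of_nat CARD('a) * of_nat (card {x \<in> I \<times> I. f (fst x) = f (snd x)})"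
    using assms by (simp add: split_def sum.If_cases Int_def)
  also have "{x \<in> I \<times> I. f (fst x) = f (snd x)} = {(i, j). i \<in> I \<and> j \<in> I \<and> f i = f j}" by auto
  finally have "complex_of_real (\<Sum>b\<in>UNIV. (norm (\<Sum>i\<in>I. psi (b * f i)))\<^sup>2)
    = complex_of_real (real CARD('a) * real (card {(i, j). i \<in> I \<and> j \<in> I \<and> f i = f j}))"
    by simp
  then show ?thesis by (simp only: of_real_eq_iff)
qed

text \<open>
  Splitting the cube of the exponential sum according to the product of the three summands
  costs only a factor \<open>m\<close> in the Cauchy-Schwarz inequality, and the resulting pairs of triples with
  equal sum and equal product are parametrised by collinear triples of points.
\<close>

lemma exponential_sum_power6_le:
  assumes m: "0 < m" "card (unity_roots m :: 'a set) = m" and a: "a \<noteq> 0"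
  shows "norm (\<Sum>h\<in>unity_roots m. psi (a * h)) ^ 6
    \<le> real CARD('a) * real (card (sum_product_pairs m :: (('a \<times> 'a \<times> 'a) \<times> _) set)) - real m ^ 5"
proof -
  let ?H = "unity_roots m :: 'a set"
  define S where "S b = (\<Sum>h\<in>?H. psi (b * h))" for b
  define I where "I q = {(u1, u2, u3). u1 \<in> ?H \<and> u2 \<in> ?H \<and> u3 \<in> ?H \<and> u1 * u2 * u3 = q}" for q
  define \<sigma> where "\<sigma> = (\<lambda>(u1 :: 'a, u2, u3). u1 + u2 + u3)"
  define G where "G q b = (\<Sum>u\<in>I q. psi (b * \<sigma> u))" for q b
  have nonzero [simp]: "x \<in> ?H \<Longrightarrow> x \<noteq> 0" for x using m(1) by (rule unity_roots_nonzero[rotated])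
  have cube: "S b ^ 3 = (\<Sum>q\<in>?H. G q b)" for b
  proof -
    have "S b ^ 3 = S b * (S b * S b)" by (simp add: power3_eq_cube)
    also have "S b * S b = (\<Sum>(u2, u3)\<in>?H \<times> ?H. psi (b * u2) * psi (b * u3))"
      by (simp add: S_def sum_product sum.cartesian_product)
    also have "S b * \<dots> = (\<Sum>u1\<in>?H. \<Sum>v\<in>?H \<times> ?H. psi (b * u1) * (case v of (u2, u3) \<Rightarrow> psi (b * u2) * psi (b * u3)))"
      unfolding S_def by (rule sum_product)
    also have "\<dots> = (\<Sum>(u1, u2, u3)\<in>?H \<times> ?H \<times> ?H. psi (b * u1) * (psi (b * u2) * psi (b * u3)))"
      by (simp add: sum.cartesian_product split_def)
    also have "\<dots> = (\<Sum>u\<in>?H \<times> ?H \<times> ?H. psi (b * \<sigma> u))"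
      by (intro sum.cong refl) (auto simp: \<sigma>_def distrib_left psi_add mult.assoc)
    also have "?H \<times> ?H \<times> ?H = (\<Union>q\<in>?H. I q)"
      by (auto simp: I_def unity_roots_mult)
    also have "(\<Sum>u\<in>\<dots>. psi (b * \<sigma> u)) = (\<Sum>q\<in>?H. G q b)"
      unfolding G_def by (rule sum.UNION_disjoint) (auto simp: I_def)
    finally show ?thesis .
  qed
  have "norm (S b) ^ 6 \<le> m * (\<Sum>q\<in>?H. (norm (G q b))\<^sup>2)" for b
  proof -
    have "norm (S b) ^ 6 = (norm (S b ^ 3))\<^sup>2" by (simp add: norm_power flip: power_mult)
    also have "\<dots> \<le> (\<Sum>q\<in>?H. norm (G q b))\<^sup>2"
      unfolding cube by (intro power_mono norm_sum) simp
    also have "\<dots> \<le> m * (\<Sum>q\<in>?H. (norm (G q b))\<^sup>2)"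
      using sum_squared_le_sum_of_squares[of "\<lambda>q. norm (G q b)" ?H] m by (simp add: mult.commute)
    finally show ?thesis .
  qed
  \<comment> \<open>Frequency 0 is left out: there each \<open>G q 0\<close> equals
    \<open>m\<^sup>2\<close>, and the sum of their squares is the \<open>m ^ 5\<close> that later
    cancels the mean part of the triple count.\<close>
  then have "(\<Sum>b\<in>-{0}. norm (S b) ^ 6) \<le> (\<Sum>b\<in>-{0}. m * (\<Sum>q\<in>?H. (norm (G q b))\<^sup>2))"
    by (rule sum_mono)
  also have "\<dots> = m * (\<Sum>q\<in>?H. \<Sum>b\<in>-{0}. (norm (G q b))\<^sup>2)"
    unfolding sum_distrib_left[symmetric] by (subst sum.swap) simp
  also have "(\<Sum>q\<in>?H. \<Sum>b\<in>-{0}. (norm (G q b))\<^sup>2)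
    = real CARD('a) * real (card (sum_product_pairs m :: (('a \<times> 'a \<times> 'a) \<times> _) set)) - real m ^ 5"
  proof -
    define N where "N q = {(i, j). i \<in> I q \<and> j \<in> I q \<and> \<sigma> i = \<sigma> j}" for q
    have "(\<Sum>b\<in>-{0}. (norm (G q b))\<^sup>2) = real CARD('a) * real (card (N q)) - real m ^ 4" if q: "q \<in> ?H" for q
    proof -
      have "bij_betw (\<lambda>(u1, u2). (u1, u2, q / (u1 * u2))) (?H \<times> ?H) (I q)"
        using q m(1) by (intro bij_betw_byWitness[where f' = "\<lambda>(u1, u2, u3). (u1, u2)"])
          (auto simp: I_def field_simps intro!: unity_roots_divide unity_roots_mult)
      then have "card (I q) = m * m"
        using bij_betw_same_card card_cartesian_product[of ?H ?H] m(2) by fastforce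
      then have G0: "norm (G q 0) = real m ^ 2" by (simp add: G_def psi_0 power2_eq_square flip: of_nat_mult)
      have "(\<Sum>b\<in>-{0}. (norm (G q b))\<^sup>2) = (\<Sum>b\<in>UNIV. (norm (G q b))\<^sup>2) - (norm (G q 0))\<^sup>2"
        by (subst sum.remove[of UNIV 0]) (simp_all add: Compl_eq_Diff_UNIV)
      then show ?thesis unfolding G0 N_def
        using parseval[of "I q" \<sigma>] by (simp add: G_def flip: power_mult)
    qed
    then have "(\<Sum>q\<in>?H. \<Sum>b\<in>-{0}. (norm (G q b))\<^sup>2) = real CARD('a) * real (\<Sum>q\<in>?H. card (N q)) - real m * real m ^ 4"
      by (simp add: sum_subtractf m(2) sum_distrib_left)
    also have "(\<Sum>q\<in>?H. card (N q)) = card (\<Union>q\<in>?H. N q)"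
      by (rule card_UN_disjoint[symmetric]) (auto simp: N_def I_def)
    also have "(\<Union>q\<in>?H. N q) = sum_product_pairs m"
      by (auto simp: N_def I_def \<sigma>_def sum_product_pairs_def unity_roots_mult)
    finally show ?thesis by (simp flip: power_Suc)
  qed
  finally have up: "(\<Sum>b\<in>-{0}. norm (S b) ^ 6)
    \<le> m * (real CARD('a) * real (card (sum_product_pairs m :: (('a \<times> 'a \<times> 'a) \<times> _) set)) - real m ^ 5)" .
  have inv: "S (a * h) = S a" if h: "h \<in> ?H" for h
  proof -
    have "bij_betw ((*) h) ?H ?H"
      using h m(1) by (intro bij_betw_byWitness[where f' = "\<lambda>x. x / h"])
        (auto intro!: unity_roots_divide unity_roots_mult)
    then show ?thesis
      unfolding S_def by (subst sum.reindex_bij_betw[symmetric]) (simp_all add: mult.assoc)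
  qed
  \<comment> \<open>The \<open>m\<close> nonzero frequencies \<open>a * h\<close> contribute
    equally, which makes up for the factor \<open>m\<close> lost in the Cauchy-Schwarz
    inequality.\<close>
  have "real m * norm (S a) ^ 6 = (\<Sum>h\<in>?H. norm (S (a * h)) ^ 6)" by (simp add: inv m(2))
  also have "\<dots> = (\<Sum>b\<in>(*) a ` ?H. norm (S b) ^ 6)"
    using a by (subst sum.reindex) (auto intro: inj_onI)
  also have "\<dots> \<le> (\<Sum>b\<in>-{0}. norm (S b) ^ 6)"
    using a m(1) by (intro sum_mono2) (auto dest: unity_roots_nonzero)
  also note up
  finally show ?thesis using m(1) unfolding S_def by simp
qed

end

section \<open>Incidences between lines and pairs of roots of unity\<close>

text \<open>Lines are given by slope and intercept, points by their first coordinate; triples on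
  vertical lines are counted separately.\<close>

definition line_points :: "nat \<Rightarrow> 'a::field \<Rightarrow> 'a \<Rightarrow> 'a set" where
  "line_points m \<alpha> \<beta> = {x \<in> unity_roots m. \<alpha> * x + \<beta> \<in> unity_roots m}"

definition incidences :: "nat \<Rightarrow> 'a::field \<times> 'a \<Rightarrow> nat" where
  "incidences m l = card (line_points m (fst l) (snd l))"

section \<open>Double counting and moments of the incidence numbers\<close>

lemma sum_card_swap:
  assumes "finite L" "finite T"
  shows "(\<Sum>l\<in>L. card {t \<in> T. P l t}) = (\<Sum>t\<in>T. card {l \<in> L. P l t})"
proof -
  have "(\<Sum>l\<in>L. card {t \<in> T. P l t}) = (\<Sum>l\<in>L. \<Sum>t\<in>T. if P l t then 1 else 0)"
    using assms by (simp add: sum.If_cases Int_def)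
  also have "\<dots> = (\<Sum>t\<in>T. \<Sum>l\<in>L. if P l t then 1 else 0)" by (rule sum.swap)
  also have "\<dots> = (\<Sum>t\<in>T. card {l \<in> L. P l t})"
    using assms by (simp add: sum.If_cases Int_def)
  finally show ?thesis .
qed

lemma card_lines_through_point:
  "card {l :: 'a::{finite, field} \<times> 'a. fst l * x + snd l \<in> H} = CARD('a) * card H"
proof -
  have "bij_betw (\<lambda>l. (fst l, fst l * x + snd l)) {l :: 'a \<times> 'a. fst l * x + snd l \<in> H} (UNIV \<times> H)"
    by (rule bij_betw_byWitness[where f' = "\<lambda>(\<alpha>, y). (\<alpha>, y - \<alpha> * x)"]) auto
  from bij_betw_same_card[OF this] show ?thesis by (simp add: card_cartesian_product)
qed

lemma card_lines_through_two_points: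
  fixes x x' :: "'a::{finite, field}"
  assumes "x \<noteq> x'"
  shows "card {l. fst l * x + snd l \<in> H \<and> fst l * x' + snd l \<in> H} = card H * card H"
proof -
  define slope where "slope y y' = (y - y') / (x - x')" for y y'
  have 1: "slope y y' * x' + (y - slope y y' * x) = y'" for y y'
    using assms unfolding slope_def by (simp add: divide_simps) (simp add: algebra_simps)
  have 2: "slope (a * x + b) (a * x' + b) = a" for a b
    using assms unfolding slope_def by (simp add: divide_simps) (simp add: algebra_simps)
  have "bij_betw (\<lambda>l. (fst l * x + snd l, fst l * x' + snd l))
      {l. fst l * x + snd l \<in> H \<and> fst l * x' + snd l \<in> H} (H \<times> H)"
    by (rule bij_betw_byWitness[where f' = "\<lambda>(y, y'). (slope y y', y - slope y y' * x)"]) (auto simp: 1 2)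
  from bij_betw_same_card[OF this] show ?thesis by (simp add: card_cartesian_product)
qed

lemma sum_incidences:
  assumes "card (unity_roots m :: 'a::{finite, field} set) = m"
  shows "(\<Sum>l\<in>(UNIV :: ('a \<times> 'a) set). incidences m l) = CARD('a) * m\<^sup>2"
proof -
  have "(\<Sum>l\<in>(UNIV :: ('a \<times> 'a) set). incidences m l)
      = (\<Sum>x\<in>unity_roots m. card {l :: 'a \<times> 'a. fst l * x + snd l \<in> unity_roots m})"
    unfolding incidences_def line_points_def by (subst sum_card_swap) simp_all
  then show ?thesis by (simp add: card_lines_through_point assms power2_eq_square)
qed

text \<open>Two distinct abscissas admit \<open>m\<^sup>2\<close> lines, equal ones
  \<open>CARD('a) * m\<close>. The term \<open>m ^ 3\<close> stands on the left to avoid a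
  subtraction of naturals.\<close>

lemma sum_incidences_squares:
  assumes "card (unity_roots m :: 'a::{finite, field} set) = m"
  shows "(\<Sum>l\<in>(UNIV :: ('a \<times> 'a) set). (incidences m l)\<^sup>2) + m ^ 3 = CARD('a) * m\<^sup>2 + m ^ 4"
proof -
  let ?H = "unity_roots m :: 'a set"
  have sq: "(incidences m l)\<^sup>2
      = card {t \<in> ?H \<times> ?H. fst l * fst t + snd l \<in> ?H \<and> fst l * snd t + snd l \<in> ?H}" for l :: "'a \<times> 'a"
  proof -
    have "{t \<in> ?H \<times> ?H. fst l * fst t + snd l \<in> ?H \<and> fst l * snd t + snd l \<in> ?H}
      = line_points m (fst l) (snd l) \<times> line_points m (fst l) (snd l)"
      by (auto simp: line_points_def)
    then show ?thesis by (simp add: card_cartesian_product power2_eq_square incidences_def)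
  qed
  have "(\<Sum>l\<in>(UNIV :: ('a \<times> 'a) set). (incidences m l)\<^sup>2)
      = (\<Sum>t\<in>?H \<times> ?H. card {l. fst l * fst t + snd l \<in> ?H \<and> fst l * snd t + snd l \<in> ?H})"
    unfolding sq by (subst sum_card_swap) simp_all
  also have "\<dots> = (\<Sum>x\<in>?H. \<Sum>x'\<in>?H. card {l. fst l * x + snd l \<in> ?H \<and> fst l * x' + snd l \<in> ?H})"
    by (simp add: sum.cartesian_product split_def)
  also have "\<dots> = (\<Sum>x\<in>?H. CARD('a) * m + (m - 1) * m\<^sup>2)"
  proof (rule sum.cong[OF refl])
    fix x assume x: "x \<in> ?H"
    have "(\<Sum>x'\<in>?H. card {l. fst l * x + snd l \<in> ?H \<and> fst l * x' + snd l \<in> ?H})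
      = CARD('a) * m + (\<Sum>x'\<in>?H - {x}. card {l. fst l * x + snd l \<in> ?H \<and> fst l * x' + snd l \<in> ?H})"
      using x by (subst sum.remove[of _ x]) (simp_all add: card_lines_through_point assms)
    also have "(\<Sum>x'\<in>?H - {x}. card {l. fst l * x + snd l \<in> ?H \<and> fst l * x' + snd l \<in> ?H})
      = (\<Sum>x'\<in>?H - {x}. m\<^sup>2)"
      by (intro sum.cong refl, subst card_lines_through_two_points) (auto simp: assms power2_eq_square)
    also have "\<dots> = (m - 1) * m\<^sup>2" using x assms by simp
    finally show "(\<Sum>x'\<in>?H. card {l. fst l * x + snd l \<in> ?H \<and> fst l * x' + snd l \<in> ?H})
      = CARD('a) * m + (m - 1) * m\<^sup>2" .
  qed
  also have "\<dots> = m * (CARD('a) * m + (m - 1) * m\<^sup>2)" by (simp add: assms)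
  finally show ?thesis
    by (cases m) (simp_all add: power2_eq_square power3_eq_cube power4_eq_xxxx algebra_simps)
qed

text \<open>Triples with a common first coordinate, in particular constant ones, are covered by
  \<open>m ^ 4\<close>. Constant triples must not be counted again on each of the
  \<open>CARD('a)\<close> lines through their point; hence the subtracted
  \<open>incidences m l\<close>.\<close>

lemma card_collinear_triples_le:
  assumes "card (unity_roots m :: 'a::{finite, field} set) = m"
  shows "card (collinear_triples m :: (('a \<times> 'a) \<times> _) set)
    \<le> m ^ 4 + (\<Sum>l\<in>(UNIV :: ('a \<times> 'a) set). incidences m l ^ 3 - incidences m l)"
proof -
  let ?H = "unity_roots m :: 'a set"
  define V where "V = (\<lambda>(a :: 'a, b1 :: 'a, b2 :: 'a, b3 :: 'a). ((a, b1), (a, b2), (a, b3))) ` (?H \<times> ?H \<times> ?H \<times> ?H)"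
  define D where "D l = line_points m (fst l) (snd l) \<times> line_points m (fst l) (snd l) \<times> line_points m (fst l) (snd l)
    - (\<lambda>x. (x, x, x)) ` line_points m (fst l) (snd l)" for l :: "'a \<times> 'a"
  define W where "W l = (\<lambda>(x1, x2, x3). ((x1, fst l * x1 + snd l), (x2, fst l * x2 + snd l), (x3, fst l * x3 + snd l))) ` D l"
    for l :: "'a \<times> 'a"
  have V: "card V \<le> m ^ 4"
    unfolding V_def using card_image_le[of "?H \<times> ?H \<times> ?H \<times> ?H" "\<lambda>(a, b1, b2, b3). ((a, b1), (a, b2), (a, b3))"] assms
    by (simp add: card_cartesian_product power4_eq_xxxx mult.assoc)
  have W: "card (W l) \<le> incidences m l ^ 3 - incidences m l" for l
  proof -
    have "card (W l) \<le> card (D l)" unfolding W_def by (rule card_image_le) simp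
    also have "\<dots> = incidences m l ^ 3 - card ((\<lambda>x. (x, x, x)) ` line_points m (fst l) (snd l))"
      unfolding D_def
      by (subst card_Diff_subset) (auto simp: card_cartesian_product power3_eq_cube incidences_def)
    also have "card ((\<lambda>x. (x, x, x)) ` line_points m (fst l) (snd l)) = incidences m l"
      unfolding incidences_def by (rule card_image) (auto intro: inj_onI)
    finally show ?thesis .
  qed
  have "collinear_triples m \<subseteq> V \<union> (\<Union>l. W l)"
  proof
    fix t :: "('a \<times> 'a) \<times> ('a \<times> 'a) \<times> ('a \<times> 'a)"
    assume t: "t \<in> collinear_triples m"
    obtain a1 b1 a2 b2 a3 b3 where t_eq: "t = ((a1, b1), (a2, b2), (a3, b3))" by (cases t) auto
    have H: "{a1, a2, a3, b1, b2, b3} \<subseteq> ?H" and eq: "a2 * b3 + a3 * b1 + a1 * b2 = a1 * b3 + a2 * b1 + a3 * b2"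
      using t by (auto simp: t_eq collinear_triples_def)
    show "t \<in> V \<union> (\<Union>l. W l)"
    proof (cases "a1 = a2 \<and> a2 = a3")
      case True
      then have "t \<in> V" using H unfolding V_def t_eq by (intro image_eqI[of _ _ "(a1, b1, b2, b3)"]) auto
      then show ?thesis by simp
    next
      case False
      have "\<exists>\<alpha> \<beta>. b1 = \<alpha> * a1 + \<beta> \<and> b2 = \<alpha> * a2 + \<beta> \<and> b3 = \<alpha> * a3 + \<beta>"
      proof (cases "a1 = a2")
        case True
        with False have ne: "a1 - a3 \<noteq> 0" by simp
        have "(a1 - a3) * (b1 - b2) = 0" using eq True by (simp add: algebra_simps)
        then have "b2 = b1" using ne by simp
        have "b3 = (b1 - b3) / (a1 - a3) * a3 + (b1 - (b1 - b3) / (a1 - a3) * a1)"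
          using ne by (simp add: divide_simps) (simp add: algebra_simps)
        with \<open>b2 = b1\<close> True show ?thesis
          by (intro exI[of _ "(b1 - b3) / (a1 - a3)"] exI[of _ "b1 - (b1 - b3) / (a1 - a3) * a1"]) auto
      next
        case neq: False
        then have ne: "a1 - a2 \<noteq> 0" by simp
        have "b2 = (b1 - b2) / (a1 - a2) * a2 + (b1 - (b1 - b2) / (a1 - a2) * a1)"
          using ne by (simp add: divide_simps) (simp add: algebra_simps)
        moreover have "b3 = (b1 - b2) / (a1 - a2) * a3 + (b1 - (b1 - b2) / (a1 - a2) * a1)"
        proof -
          have "(a1 - a2) * b3 = (b1 - b2) * a3 + (b1 * (a1 - a2) - (b1 - b2) * a1)"
            using eq by (simp add: algebra_simps)
          then have "b3 = ((b1 - b2) * a3 + (b1 * (a1 - a2) - (b1 - b2) * a1)) / (a1 - a2)"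
            using ne by (simp add: nonzero_eq_divide_eq mult.commute)
          then show ?thesis
            using ne by (simp only: add_divide_distrib diff_divide_distrib[of "b1 * (a1 - a2)"]
              times_divide_eq_left nonzero_mult_div_cancel_right not_False_eq_True)
        qed
        ultimately show ?thesis
          by (intro exI[of _ "(b1 - b2) / (a1 - a2)"] exI[of _ "b1 - (b1 - b2) / (a1 - a2) * a1"]) auto
      qed
      then obtain \<alpha> \<beta> where l: "b1 = \<alpha> * a1 + \<beta>" "b2 = \<alpha> * a2 + \<beta>" "b3 = \<alpha> * a3 + \<beta>" by blast
      have "(a1, a2, a3) \<in> D (\<alpha>, \<beta>)" using H False l by (auto simp: D_def line_points_def)
      then have "t \<in> W (\<alpha>, \<beta>)" unfolding W_def t_eq by (intro image_eqI[of _ _ "(a1, a2, a3)"]) (simp_all add: l)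
      then show ?thesis by blast
    qed
  qed
  then have "card (collinear_triples m :: (('a \<times> 'a) \<times> _) set) \<le> card (V \<union> (\<Union>l. W l))"
    by (rule card_mono[rotated]) simp
  also have "\<dots> \<le> card V + card (\<Union>l. W l)" by (rule card_Un_le)
  also have "card (\<Union>l. W l) \<le> (\<Sum>l\<in>UNIV. card (W l))" by (rule card_UN_le) simp
  also have "\<dots> \<le> (\<Sum>l\<in>(UNIV :: ('a \<times> 'a) set). incidences m l ^ 3 - incidences m l)" by (intro sum_mono W)
  finally show ?thesis using V by simp
qed

text \<open>The substitution \<open>y = - \<alpha> / \<beta> * x\<close> turns
  \<open>\<alpha> * x + \<beta>\<close> into \<open>\<beta> * (1 - y)\<close>.\<close>

lemma incidences_eq_card_power_fibre:
  assumes "\<alpha> \<noteq> 0" "\<beta> \<noteq> 0"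
  shows "incidences m (\<alpha>, \<beta>) = card (power_fibre m ((- \<alpha> / \<beta>) ^ m) ((1 / \<beta>) ^ m))"
proof -
  have 1: "x ^ m = 1 \<longleftrightarrow> (- \<alpha> / \<beta> * x) ^ m = (- \<alpha> / \<beta>) ^ m" for x
    using assms by (simp only: power_mult_distrib) simp
  have 2: "(\<alpha> * x + \<beta>) ^ m = 1 \<longleftrightarrow> (1 - (- \<alpha> / \<beta> * x)) ^ m = (1 / \<beta>) ^ m" for x
  proof -
    have "1 - (- \<alpha> / \<beta> * x) = (1 / \<beta>) * (\<alpha> * x + \<beta>)" using assms by (simp add: field_simps)
    then show ?thesis using assms by (simp only: power_mult_distrib) simp
  qed
  have "bij_betw (\<lambda>x. - \<alpha> / \<beta> * x) (line_points m \<alpha> \<beta>) (power_fibre m ((- \<alpha> / \<beta>) ^ m) ((1 / \<beta>) ^ m))"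
  proof (rule bij_betw_byWitness[where f' = "\<lambda>y. - \<beta> / \<alpha> * y"])
    show "(\<lambda>x. - \<alpha> / \<beta> * x) ` line_points m \<alpha> \<beta> \<subseteq> power_fibre m ((- \<alpha> / \<beta>) ^ m) ((1 / \<beta>) ^ m)"
      using 1 2 by (auto simp: line_points_def unity_roots_def power_fibre_def)
    show "(\<lambda>y. - \<beta> / \<alpha> * y) ` power_fibre m ((- \<alpha> / \<beta>) ^ m) ((1 / \<beta>) ^ m) \<subseteq> line_points m \<alpha> \<beta>"
    proof
      fix x assume "x \<in> (\<lambda>y. - \<beta> / \<alpha> * y) ` power_fibre m ((- \<alpha> / \<beta>) ^ m) ((1 / \<beta>) ^ m)"
      then have "- \<alpha> / \<beta> * x \<in> power_fibre m ((- \<alpha> / \<beta>) ^ m) ((1 / \<beta>) ^ m)"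
        using assms by auto
      then show "x \<in> line_points m \<alpha> \<beta>"
        unfolding line_points_def unity_roots_def power_fibre_def mem_Collect_eq 1[of x] 2[of x] .
    qed
  qed (use assms in auto)
  from bij_betw_same_card[OF this] show ?thesis by (simp add: incidences_def)
qed

lemma sum_rich_incidence_cubes_le:
  assumes m: "card (unity_roots m :: 'a::{finite, field} set) = m"
    and A0: "1 \<le> A0" "m\<^sup>2 \<le> A0 * CHAR('a)" "16 * A0 ^ 3 \<le> m\<^sup>2"
  shows "real (\<Sum>l\<in>{l :: 'a \<times> 'a. 97 * A0 \<le> incidences m l}. incidences m l ^ 3)
    \<le> 2 * real m ^ 4 + 1327104 * real m ^ 4 * (1 + ln (real m))"
proof -
  let ?H = "unity_roots m :: 'a set"
  let ?f = "\<lambda>l :: 'a \<times> 'a. incidences m l ^ 3"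
  have m0: "0 < m" using A0(1,3) by (cases m) auto
  define Z where "Z = {l :: 'a \<times> 'a. fst l \<noteq> 0 \<and> snd l \<noteq> 0 \<and> 97 * A0 \<le> incidences m l}"
  define \<Phi> where "\<Phi> l = ((- fst l / snd l) ^ m, (1 / snd l) ^ m)" for l :: "'a \<times> 'a"
  have inc: "incidences m l = card (power_fibre m (fst (\<Phi> l)) (snd (\<Phi> l)))" if "l \<in> Z" for l
    using that incidences_eq_card_power_fibre[of "fst l" "snd l" m] by (auto simp: Z_def \<Phi>_def)
  \<comment> \<open>The fibre fixes only the \<open>m\<close>-th powers of
    \<open>- \<alpha> / \<beta>\<close> and \<open>1 / \<beta>\<close>, so up to
    \<open>m\<^sup>2\<close> lines share it; this raises \<open>m\<^sup>2\<close> to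
    \<open>m ^ 4\<close> in the bound.\<close>
  have fib: "card {l \<in> Z. \<Phi> l = y} \<le> m\<^sup>2" for y
  proof -
    let ?R = "{x. x ^ m = fst y} \<times> {x. x ^ m = snd y}"
    have "card {l \<in> Z. \<Phi> l = y} \<le> card ?R"
    proof (rule card_inj_on_le[where f = "\<lambda>l. (- fst l / snd l, 1 / snd l)"])
      show "inj_on (\<lambda>l. (- fst l / snd l, 1 / snd l)) {l \<in> Z. \<Phi> l = y}"
        by (auto simp: inj_on_def Z_def prod_eq_iff field_simps)
    qed (auto simp: \<Phi>_def)
    also have "\<dots> \<le> m * m"
      unfolding card_cartesian_product by (intro mult_le_mono card_nth_roots_le m0)
    finally show ?thesis by (simp add: power2_eq_square)
  qed
  have "(\<Sum>l\<in>Z. ?f l) = (\<Sum>l\<in>Z. card (power_fibre m (fst (\<Phi> l)) (snd (\<Phi> l))) ^ 3)"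
    by (simp add: inc)
  also have "\<dots> = (\<Sum>y\<in>\<Phi> ` Z. \<Sum>l | l \<in> Z \<and> \<Phi> l = y. card (power_fibre m (fst (\<Phi> l)) (snd (\<Phi> l))) ^ 3)"
    by (rule sum.image_gen) simp
  also have "\<dots> = (\<Sum>y\<in>\<Phi> ` Z. card {l \<in> Z. \<Phi> l = y} * card (power_fibre m (fst y) (snd y)) ^ 3)"
    by (intro sum.cong refl) simp
  also have "\<dots> \<le> (\<Sum>y\<in>\<Phi> ` Z. m\<^sup>2 * card (power_fibre m (fst y) (snd y)) ^ 3)"
    by (intro sum_mono mult_le_mono1 fib)
  also have "\<dots> \<le> (\<Sum>y\<in>(rich_fibres m (97 * A0) :: ('a \<times> 'a) set). m\<^sup>2 * card (power_fibre m (fst y) (snd y)) ^ 3)"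
  proof (rule sum_mono2)
    show "\<Phi> ` Z \<subseteq> rich_fibres m (97 * A0)"
    proof
      fix y assume "y \<in> \<Phi> ` Z"
      then obtain l where l: "l \<in> Z" "y = \<Phi> l" by blast
      then have "97 * A0 \<le> card (power_fibre m (fst y) (snd y))" using inc[OF l(1)] by (simp add: Z_def)
      moreover have "fst y \<noteq> 0" "snd y \<noteq> 0" using l by (auto simp: Z_def \<Phi>_def)
      ultimately show "y \<in> rich_fibres m (97 * A0)" by (simp add: rich_fibres_def split_def)
    qed
  qed auto
  finally have "real (\<Sum>l\<in>Z. ?f l) \<le> real (m\<^sup>2 * (\<Sum>(c, d)\<in>(rich_fibres m (97 * A0) :: ('a \<times> 'a) set). card (power_fibre m c d) ^ 3))"
    by (simp only: of_nat_le_iff sum_distrib_left split_def)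
  also have "\<dots> \<le> (real m)\<^sup>2 * (1327104 * (real m)\<^sup>2 * (1 + ln (real m)))"
    using sum_rich_fibre_cubes_le[OF A0]
    unfolding of_nat_mult of_nat_power by (intro mult_left_mono) simp_all
  also have "\<dots> = 1327104 * real m ^ 4 * (1 + ln (real m))" by (simp add: power2_eq_square power4_eq_xxxx)
  finally have Z: "real (\<Sum>l\<in>Z. ?f l) \<le> 1327104 * real m ^ 4 * (1 + ln (real m))" .

  have le: "incidences m l \<le> m" for l :: "'a \<times> 'a"
    unfolding incidences_def using card_mono[of ?H "line_points m (fst l) (snd l)"]
    by (simp add: m line_points_def)
  \<comment> \<open>For lines with slope or intercept 0 that carry a point, the other parameter lies
    in \<open>?H\<close>: at most \<open>m\<close> lines of each kind, with at most \<open>m\<close>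
    points each.\<close>
  have axis: "(\<Sum>l\<in>X. ?f l) \<le> m ^ 4" if "inj_on e ?H" "X \<subseteq> e ` ?H" for X and e :: "'a \<Rightarrow> 'a \<times> 'a"
  proof -
    have "(\<Sum>l\<in>X. ?f l) \<le> (\<Sum>l\<in>X. m ^ 3)" by (intro sum_mono power_mono le) simp
    also have "\<dots> \<le> m * m ^ 3"
      using card_mono[OF _ that(2)] card_image[OF that(1)] m by simp
    finally show ?thesis by (simp add: eval_nat_numeral)
  qed
  define X where "X = {l :: 'a \<times> 'a. fst l = 0 \<and> 97 * A0 \<le> incidences m l}"
  define Y where "Y = {l :: 'a \<times> 'a. snd l = 0 \<and> 97 * A0 \<le> incidences m l}"
  have ne: "line_points m (fst l) (snd l) \<noteq> {}" if "97 * A0 \<le> incidences m l" for l :: "'a \<times> 'a"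
    using that A0(1) by (auto simp: incidences_def)
  have "X \<subseteq> Pair 0 ` ?H" using ne by (fastforce simp: X_def line_points_def)
  then have X: "(\<Sum>l\<in>X. ?f l) \<le> m ^ 4" by (rule axis[rotated]) (simp add: inj_on_def)
  have "Y \<subseteq> (\<lambda>a. (a, 0)) ` ?H"
  proof
    fix l :: "'a \<times> 'a" assume "l \<in> Y"
    then obtain x where x: "x \<in> ?H" "fst l * x \<in> ?H" "snd l = 0"
      using ne[of l] by (auto simp: Y_def line_points_def)
    then have "fst l * x / x \<in> ?H" by (intro unity_roots_divide)
    then have "fst l \<in> ?H" using unity_roots_nonzero[OF x(1) m0] by simp
    with x(3) show "l \<in> (\<lambda>a. (a, 0)) ` ?H" by (intro image_eqI[of _ _ "fst l"]) (simp_all add: prod_eq_iff)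
  qed
  then have Y: "(\<Sum>l\<in>Y. ?f l) \<le> m ^ 4" by (rule axis[rotated]) (simp add: inj_on_def)
  have "{l. 97 * A0 \<le> incidences m l} = Z \<union> (X \<union> Y)" by (auto simp: X_def Y_def Z_def)
  then have "(\<Sum>l\<in>{l. 97 * A0 \<le> incidences m l}. ?f l) \<le> (\<Sum>l\<in>Z. ?f l) + ((\<Sum>l\<in>X. ?f l) + (\<Sum>l\<in>Y. ?f l))"
    by (simp add: sum_Un_nat)
  also have "\<dots> \<le> (\<Sum>l\<in>Z. ?f l) + 2 * m ^ 4" using X Y by simp
  finally have "real (\<Sum>l\<in>{l. 97 * A0 \<le> incidences m l}. ?f l) \<le> real (\<Sum>l\<in>Z. ?f l) + real (2 * m ^ 4)"
    by (simp only: of_nat_le_iff flip: of_nat_add)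
  with Z show ?thesis by simp
qed

text \<open>\<open>\<mu>\<close> is the mean over all \<open>CARD('a) ^ 2\<close> lines, so the
  terms \<open>m ^ 4\<close> cancel in the variance.\<close>

lemma sum_deviation_squares_le:
  assumes m: "card (unity_roots m :: 'a::{finite, field} set) = m"
    and \<mu>: "\<mu> = (real m)\<^sup>2 / real CARD('a)"
  shows "(\<Sum>l\<in>(UNIV :: ('a \<times> 'a) set). (real (incidences m l) - \<mu>)\<^sup>2) \<le> real CARD('a) * (real m)\<^sup>2"
proof -
  define q where "q = real CARD('a)"
  have q: "0 < q" by (simp add: q_def card_gt_0_iff)
  have \<mu>q: "\<mu> * q = (real m)\<^sup>2" using q by (simp add: \<mu> q_def)
  have s1: "(\<Sum>l\<in>(UNIV :: ('a \<times> 'a) set). real (incidences m l)) = q * (real m)\<^sup>2"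
    unfolding q_def using arg_cong[OF sum_incidences[OF m], of real] by simp
  have s2: "(\<Sum>l\<in>(UNIV :: ('a \<times> 'a) set). (real (incidences m l))\<^sup>2) = q * (real m)\<^sup>2 + real m ^ 4 - real m ^ 3"
    unfolding q_def using arg_cong[OF sum_incidences_squares[OF m], of real] by simp
  have s0: "(\<Sum>l\<in>(UNIV :: ('a \<times> 'a) set). 1) = q\<^sup>2"
    by (simp add: q_def power2_eq_square flip: UNIV_Times_UNIV)
  have "(\<Sum>l\<in>(UNIV :: ('a \<times> 'a) set). (real (incidences m l) - \<mu>)\<^sup>2)
    = (\<Sum>l\<in>(UNIV :: ('a \<times> 'a) set). (real (incidences m l))\<^sup>2 - 2 * \<mu> * real (incidences m l) + \<mu>\<^sup>2 * 1)"
    by (intro sum.cong refl) (simp add: power2_eq_square algebra_simps)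
  also have "\<dots> = (q * (real m)\<^sup>2 + real m ^ 4 - real m ^ 3) - 2 * \<mu> * (q * (real m)\<^sup>2) + \<mu>\<^sup>2 * q\<^sup>2"
    unfolding sum.distrib sum_subtractf sum_distrib_left[symmetric] s0 s1 s2 ..
  also have "2 * \<mu> * (q * (real m)\<^sup>2) = 2 * (\<mu> * q) * (real m)\<^sup>2" by simp
  also have "\<mu>\<^sup>2 * q\<^sup>2 = (\<mu> * q)\<^sup>2" by (simp add: power_mult_distrib)
  finally show ?thesis unfolding \<mu>q q_def[symmetric] by (simp add: power2_eq_square power4_eq_xxxx)
qed

text \<open>
  For \<open>m\<^sup>2 < q\<close> a typical line carries at most one point, and the subtracted linear
  term \<open>\<Sum>i(l)\<close> removes these lines. For \<open>m\<^sup>2 \<ge> q\<close> the mean \<open>\<mu> = m\<^sup>2 / q\<close> of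
  \<open>i\<close> accounts for the main term \<open>m\<^sup>6 / q\<close>, and \<open>\<Sum>(i(l) - \<mu>)\<^sup>3\<close> remains.
\<close>

lemma collinear_triples_excess_le:
  assumes m: "card (unity_roots m :: 'a::{finite, field} set) = m" "4 \<le> m"
    and char: "CHAR('a) = CARD('a)" and big: "128 * m ^ 4 \<le> CARD('a) ^ 3"
  shows "real CARD('a) * real (card (collinear_triples m :: (('a \<times> 'a) \<times> _) set)) - real m ^ 6
    \<le> real CARD('a) * real m ^ 4 * (200 + 1327104 * (1 + ln (real m)))"
proof -
  define q where "q = CARD('a)"
  define C where "C = card (collinear_triples m :: (('a \<times> 'a) \<times> _) set)"
  define E where "E = 2 * real m ^ 4 + 1327104 * real m ^ 4 * (1 + ln (real m))"
  \<comment> \<open>Large enough for \<open>m\<^sup>2 \<le> A0 * q\<close>, yet at most twice the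
    mean \<open>m\<^sup>2 / q\<close> once this is at least 1. In that range \<open>big\<close>
    keeps \<open>16 * A0 ^ 3\<close> within \<open>m\<^sup>2\<close>.\<close>
  define A0 where "A0 = m\<^sup>2 div q + 1"
  let ?U = "UNIV :: ('a \<times> 'a) set"
  let ?i = "\<lambda>l :: 'a \<times> 'a. incidences m l"
  have q: "0 < q" by (simp add: q_def card_gt_0_iff)
  have A0q: "m\<^sup>2 \<le> A0 * q"
    using dividend_less_times_div[OF q, of "m\<^sup>2"] by (simp add: A0_def algebra_simps)
  have m16: "16 \<le> m\<^sup>2" using power_mono[OF m(2), of 2] by simp
  have A0m: "16 * A0 ^ 3 \<le> m\<^sup>2"
  proof (cases "m\<^sup>2 < q")
    case True
    then show ?thesis using m16 by (simp add: A0_def)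
  next
    case False
    then have "1 \<le> m\<^sup>2 div q" using q by (simp add: Suc_le_eq div_greater_zero_iff)
    then have "A0 \<le> 2 * (m\<^sup>2 div q)" by (simp add: A0_def)
    then have "A0 * q \<le> 2 * (m\<^sup>2 div q) * q" by (rule mult_le_mono1)
    also have "\<dots> = 2 * (m\<^sup>2 div q * q)" by simp
    also have "\<dots> \<le> 2 * m\<^sup>2" by (intro mult_le_mono2 div_times_less_eq_dividend)
    finally have le: "A0 * q \<le> 2 * m\<^sup>2" .
    have "16 * A0 ^ 3 * q ^ 3 = 16 * (A0 * q) ^ 3" by (simp add: power_mult_distrib)
    also have "\<dots> \<le> 16 * (2 * m\<^sup>2) ^ 3" using le by (intro mult_le_mono2 power_mono) auto
    also have "\<dots> = m\<^sup>2 * (128 * m ^ 4)"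
      by (simp add: power2_eq_square power3_eq_cube power4_eq_xxxx)
    also have "\<dots> \<le> m\<^sup>2 * q ^ 3" using big unfolding q_def by (rule mult_le_mono2)
    finally show ?thesis using q by simp
  qed
  have A0: "1 \<le> A0" "m\<^sup>2 \<le> A0 * CHAR('a)" "16 * A0 ^ 3 \<le> m\<^sup>2"
    using A0q A0m by (simp_all add: A0_def char q_def)
  define R where "R = {l :: 'a \<times> 'a. 97 * A0 \<le> ?i l}"
  have E: "(\<Sum>l\<in>R. real (?i l) ^ 3) \<le> E"
    using sum_rich_incidence_cubes_le[OF m(1) A0] by (simp add: R_def E_def)
  have "?i l \<le> ?i l ^ 3" for l by (cases "?i l = 0") (simp_all add: self_le_power)
  then have cubes: "real (\<Sum>l\<in>?U. ?i l ^ 3 - ?i l) = (\<Sum>l\<in>?U. real (?i l) ^ 3 - real (?i l))"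
    by (simp add: of_nat_diff)
  have "C \<le> m ^ 4 + (\<Sum>l\<in>?U. ?i l ^ 3 - ?i l)"
    unfolding C_def by (rule card_collinear_triples_le[OF m(1)])
  then have "real C \<le> real (m ^ 4 + (\<Sum>l\<in>?U. ?i l ^ 3 - ?i l))" by (simp only: of_nat_le_iff)
  then have C: "real C \<le> real m ^ 4 + (\<Sum>l\<in>?U. real (?i l) ^ 3 - real (?i l))"
    by (simp only: of_nat_add of_nat_power cubes)
  have split: "(\<Sum>l\<in>?U. f l) = (\<Sum>l\<in>R. f l) + (\<Sum>l\<in>-R. f l)" for f :: "_ \<Rightarrow> real"
    using sum.union_disjoint[of R "-R" f] by simp
  have s1: "(\<Sum>l\<in>?U. real (?i l)) = real q * (real m)\<^sup>2"
    unfolding q_def using arg_cong[OF sum_incidences[OF m(1)], of real] by simp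
  have s2: "(\<Sum>l\<in>?U. (real (?i l))\<^sup>2) = real q * (real m)\<^sup>2 + real m ^ 4 - real m ^ 3"
    unfolding q_def using arg_cong[OF sum_incidences_squares[OF m(1)], of real] by simp
  have "real q * real C - real m ^ 6 \<le> real q * (198 * real m ^ 4 + E)"
  proof (cases "m\<^sup>2 < q")
    case True
    then have "A0 = 1" by (simp add: A0_def)
    \<comment> \<open>By \<open>x ^ 3 - x = (x + 1) * (x\<^sup>2 - x)\<close>. In the sum of
      \<open>x\<^sup>2 - x\<close> over all lines the large first moment
      \<open>q * m\<^sup>2\<close> cancels.\<close>
    have "(\<Sum>l\<in>-R. real (?i l) ^ 3 - real (?i l)) \<le> (\<Sum>l\<in>-R. 97 * ((real (?i l))\<^sup>2 - real (?i l)))"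
    proof (rule sum_mono)
      fix l assume "l \<in> - R"
      then have "?i l + 1 \<le> 97" using \<open>A0 = 1\<close> by (simp add: R_def)
      then have "real (?i l) + 1 \<le> 97" by linarith
      moreover have "0 \<le> real (?i l) * (real (?i l) - 1)" by (cases "?i l = 0") simp_all
      ultimately have "(real (?i l) + 1) * (real (?i l) * (real (?i l) - 1)) \<le> 97 * (real (?i l) * (real (?i l) - 1))"
        by (rule mult_right_mono)
      then show "real (?i l) ^ 3 - real (?i l) \<le> 97 * ((real (?i l))\<^sup>2 - real (?i l))"
        by (simp add: power2_eq_square power3_eq_cube algebra_simps)
    qed
    also have "\<dots> \<le> (\<Sum>l\<in>?U. 97 * ((real (?i l))\<^sup>2 - real (?i l)))"
      by (intro sum_mono2) (auto simp: power2_eq_square of_nat_diff intro!: self_le_power simp flip: of_nat_mult)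
    also have "\<dots> = 97 * (real m ^ 4 - real m ^ 3)"
      unfolding sum_distrib_left[symmetric] sum_subtractf s1 s2 by simp
    also have "\<dots> \<le> 97 * real m ^ 4" by simp
    finally have "(\<Sum>l\<in>-R. real (?i l) ^ 3 - real (?i l)) \<le> 97 * real m ^ 4" .
    moreover have "(\<Sum>l\<in>R. real (?i l) ^ 3 - real (?i l)) \<le> E"
      by (rule order.trans[OF sum_mono E]) simp
    ultimately have "real C \<le> 98 * real m ^ 4 + E" using C unfolding split by linarith
    then have "real q * real C \<le> real q * (198 * real m ^ 4 + E)"
      by (intro mult_left_mono) (auto intro: order.trans)
    then show ?thesis by (smt (verit) zero_le_power of_nat_0_le_iff)
  next
    case False
    define \<mu> where "\<mu> = (real m)\<^sup>2 / real q"
    have \<mu>q: "\<mu> * real q = (real m)\<^sup>2" using q by (simp add: \<mu>_def)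
    have \<mu>1: "1 \<le> \<mu>" using False q by (simp add: \<mu>_def le_divide_eq_1 flip: of_nat_power)
    have "real (m\<^sup>2 div q * q) \<le> real (m\<^sup>2)" by (simp only: of_nat_le_iff div_times_less_eq_dividend)
    then have "real (m\<^sup>2 div q) \<le> \<mu>" using q by (simp add: \<mu>_def pos_le_divide_eq)
    then have A\<mu>: "real A0 \<le> 2 * \<mu>" using \<mu>1 by (simp add: A0_def)
    have "real (m\<^sup>2) \<le> real (A0 * q)" using A0q by (simp only: of_nat_le_iff)
    then have "real q * \<mu> \<le> real q * real A0" by (simp add: mult.commute[of "real q"] \<mu>q)
    then have \<mu>A: "\<mu> \<le> real A0" using q by simp
    let ?d = "\<lambda>l. real (?i l) - \<mu>"
    have var: "(\<Sum>l\<in>?U. (?d l)\<^sup>2) \<le> real q * (real m)\<^sup>2"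
      using sum_deviation_squares_le[OF m(1), of \<mu>] by (simp add: \<mu>_def q_def)
    \<comment> \<open>The cubes are signed and only an upper bound is wanted, so negative deviations
      do no harm; \<open>194 = 2 * 97\<close>.\<close>
    have "(\<Sum>l\<in>-R. ?d l ^ 3) \<le> (\<Sum>l\<in>-R. 194 * \<mu> * (?d l)\<^sup>2)"
    proof (rule sum_mono)
      fix l assume "l \<in> -R"
      then have "real (?i l) \<le> real (97 * A0)" by (simp add: R_def)
      then have "?d l \<le> 194 * \<mu>" using A\<mu> \<mu>1 by simp
      then have "?d l * (?d l)\<^sup>2 \<le> 194 * \<mu> * (?d l)\<^sup>2" by (rule mult_right_mono) simp
      then show "?d l ^ 3 \<le> 194 * \<mu> * (?d l)\<^sup>2" by (simp add: power2_eq_square power3_eq_cube)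
    qed
    also have "\<dots> \<le> (\<Sum>l\<in>?U. 194 * \<mu> * (?d l)\<^sup>2)" using \<mu>1 by (intro sum_mono2) auto
    also have "\<dots> \<le> 194 * \<mu> * (real q * (real m)\<^sup>2)"
      unfolding sum_distrib_left[symmetric] using var \<mu>1 by (intro mult_left_mono) auto
    also have "\<dots> = 194 * (\<mu> * real q) * (real m)\<^sup>2" by simp
    also have "\<dots> = 194 * real m ^ 4" unfolding \<mu>q by (simp flip: power_add)
    finally have low: "(\<Sum>l\<in>-R. ?d l ^ 3) \<le> 194 * real m ^ 4" .
    have "(\<Sum>l\<in>R. ?d l ^ 3) \<le> (\<Sum>l\<in>R. real (?i l) ^ 3)"
    proof (rule sum_mono)
      fix l assume "l \<in> R"
      then have "97 * A0 \<le> ?i l" by (simp add: R_def)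
      then have "real A0 \<le> real (?i l)" by linarith
      then have "0 \<le> ?d l" using \<mu>A by simp
      then show "?d l ^ 3 \<le> real (?i l) ^ 3" using \<mu>1 by (intro power_mono) auto
    qed
    then have dev: "(\<Sum>l\<in>?U. ?d l ^ 3) \<le> 194 * real m ^ 4 + E"
      using low E unfolding split by linarith
    have s0: "(\<Sum>l\<in>?U. 1) = (real q)\<^sup>2"
      by (simp add: q_def power2_eq_square flip: UNIV_Times_UNIV)
    \<comment> \<open>Expansion about the mean. With the moments inserted,
      \<open>\<mu> * m ^ 4\<close> is the main term: multiplied by \<open>q\<close> it is exactly
      the \<open>m ^ 6\<close> to be subtracted.\<close>
    have "(\<Sum>l\<in>?U. real (?i l) ^ 3) = (\<Sum>l\<in>?U. ?d l ^ 3 + 3 * \<mu> * (real (?i l))\<^sup>2 - 3 * \<mu>\<^sup>2 * real (?i l) + \<mu> ^ 3 * 1)"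
      by (intro sum.cong refl) (simp add: power2_eq_square power3_eq_cube algebra_simps)
    also have "\<dots> = (\<Sum>l\<in>?U. ?d l ^ 3) + 3 * \<mu> * (real q * (real m)\<^sup>2 + real m ^ 4 - real m ^ 3)
        - 3 * \<mu>\<^sup>2 * (real q * (real m)\<^sup>2) + \<mu> ^ 3 * (real q)\<^sup>2"
      unfolding sum.distrib sum_subtractf sum_distrib_left[symmetric] s0 s1 s2 ..
    also have "\<dots> = (\<Sum>l\<in>?U. ?d l ^ 3) + 3 * (\<mu> * real q) * (real m)\<^sup>2 + 3 * \<mu> * real m ^ 4 - 3 * \<mu> * real m ^ 3
        - 3 * \<mu> * (\<mu> * real q) * (real m)\<^sup>2 + \<mu> * (\<mu> * real q)\<^sup>2"
      by (simp add: power2_eq_square power3_eq_cube algebra_simps)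
    also have "\<dots> = (\<Sum>l\<in>?U. ?d l ^ 3) + 3 * real m ^ 4 - 3 * \<mu> * real m ^ 3 + \<mu> * real m ^ 4"
      unfolding \<mu>q by (simp add: power2_eq_square power4_eq_xxxx)
    also have "\<dots> \<le> (\<Sum>l\<in>?U. ?d l ^ 3) + 3 * real m ^ 4 + \<mu> * real m ^ 4" using \<mu>1 by simp
    finally have cubes: "(\<Sum>l\<in>?U. real (?i l) ^ 3) \<le> (\<Sum>l\<in>?U. ?d l ^ 3) + 3 * real m ^ 4 + \<mu> * real m ^ 4" .
    have "(\<Sum>l\<in>?U. real (?i l) ^ 3 - real (?i l)) \<le> (\<Sum>l\<in>?U. real (?i l) ^ 3)" by (intro sum_mono) simp
    then have "real C \<le> (198 * real m ^ 4 + E) + \<mu> * real m ^ 4" using C cubes dev by linarith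
    then have "real q * real C \<le> real q * ((198 * real m ^ 4 + E) + \<mu> * real m ^ 4)" by (rule mult_left_mono) simp
    also have "\<dots> = real q * (198 * real m ^ 4 + E) + (\<mu> * real q) * real m ^ 4" by (simp add: algebra_simps)
    also have "(\<mu> * real q) * real m ^ 4 = real m ^ 6" unfolding \<mu>q by (simp flip: power_add)
    finally show ?thesis by simp
  qed
  also have "\<dots> = real q * real m ^ 4 * (200 + 1327104 * (1 + ln (real m)))"
    by (simp add: E_def algebra_simps)
  finally show ?thesis by (simp only: q_def C_def)
qed

section \<open>The exponential sum over a field of prime order\<close>

lemma half_le_ln: "2 \<le> m \<Longrightarrow> 1 / 2 \<le> ln (real m)"
proof -
  assume "2 \<le> m"
  then have "1 / real m \<le> 1 / 2" by (simp add: field_simps)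
  moreover have "1 - 1 / real m \<le> ln (real m)"
    using ln_one_minus_pos_upper_bound ln_le_minus_one[of "1 / real m"] \<open>2 \<le> m\<close> by (simp add: ln_div)
  ultimately show "1 / 2 \<le> ln (real m)" by linarith
qed

context additive_character
begin

lemma exponential_sum_bound:
  assumes m: "card (unity_roots m :: 'a set) = m" "2 \<le> m"
    and char: "CHAR('a) = CARD('a)" and mq: "m ^ 3 \<le> CARD('a)\<^sup>2" and a: "a \<noteq> 0"
  shows "norm (\<Sum>h\<in>unity_roots m. psi (a * h)) ^ 6 \<le> 5000000 * (real CARD('a) * real m ^ 3 * ln (real m))"
proof -
  let ?q = "CARD('a)"
  define M where "M = norm (\<Sum>h\<in>unity_roots m. psi (a * h))"
  have ln2: "1 / 2 \<le> ln (real m)" by (rule half_le_ln[OF m(2)])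
  have q: "1 \<le> ?q" by (simp add: Suc_le_eq card_gt_0_iff)
  \<comment> \<open>\<open>2097152 = 128 ^ 3\<close>. Here \<open>M \<le> m\<close> suffices, as
    \<open>ln m \<ge> 1 / 2\<close> and twice this number lies below the final constant.\<close>
  have trivial: "M ^ 6 \<le> 5000000 * (real ?q * real m ^ 3 * ln (real m))" if "m ^ 3 \<le> 2097152 * ?q"
  proof -
    have "M \<le> (\<Sum>h\<in>(unity_roots m :: 'a set). 1)"
      unfolding M_def by (rule order.trans[OF norm_sum]) (simp add: norm_psi)
    then have "M \<le> real m" by (simp add: m(1))
    then have "M ^ 6 \<le> real m ^ 6" by (intro power_mono) (simp_all add: M_def)
    also have "\<dots> = real m ^ 3 * real (m ^ 3)" by (simp flip: power_add)
    also have "\<dots> \<le> real m ^ 3 * real (2097152 * ?q)"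
      using that by (intro mult_left_mono) (simp_all only: of_nat_le_iff zero_le_power of_nat_0_le_iff)
    also have "\<dots> = real ?q * real m ^ 3 * 2097152" by simp
    also have "\<dots> \<le> real ?q * real m ^ 3 * (5000000 * ln (real m))"
      using ln2 by (intro mult_left_mono) auto
    finally show ?thesis by simp
  qed
  have "M ^ 6 \<le> 5000000 * (real ?q * real m ^ 3 * ln (real m))"
  proof (cases "m < 4")
    case True
    then have "m ^ 3 \<le> 4 ^ 3" by (intro power_mono) auto
    also have "\<dots> \<le> 2097152 * ?q" using q by simp
    finally show ?thesis by (rule trivial)
  next
    case m4: False
    show ?thesis
    proof (cases "128 * m ^ 4 \<le> ?q ^ 3")
      case False
      \<comment> \<open>Failure of \<open>128 * m ^ 4 \<le> q ^ 3\<close> combined with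
        \<open>m ^ 3 \<le> q\<^sup>2\<close> leaves only small \<open>q\<close>: cube the former,
        raise the latter to the fourth power.\<close>
      have "?q ^ 8 * ?q = (?q ^ 3) ^ 3" by (simp flip: power_mult power_Suc2)
      also have "\<dots> \<le> (128 * m ^ 4) ^ 3" using False by (intro power_mono) auto
      also have "\<dots> = 2097152 * (m ^ 3) ^ 4" by (simp add: power_mult_distrib flip: power_mult)
      also have "\<dots> \<le> 2097152 * (?q\<^sup>2) ^ 4" using mq by (intro mult_le_mono2 power_mono) auto
      also have "\<dots> = ?q ^ 8 * 2097152" by (simp flip: power_mult)
      finally have "?q \<le> 2097152" using q by simp
      have "m ^ 3 \<le> ?q * ?q" using mq by (simp add: power2_eq_square)
      also have "\<dots> \<le> 2097152 * ?q" using \<open>?q \<le> 2097152\<close> by (rule mult_le_mono1)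
      finally show ?thesis by (rule trivial)
    next
      case True
      let ?T = "real (card (sum_product_pairs m :: (('a \<times> 'a \<times> 'a) \<times> _) set))"
      let ?C = "real (card (collinear_triples m :: (('a \<times> 'a) \<times> _) set))"
      have T: "real m * ?T \<le> ?C"
        using sum_product_pairs_le_collinear_triples[OF _ m(1)] m(2) by (simp flip: of_nat_mult)
      have "M ^ 6 \<le> real ?q * ?T - real m ^ 5"
        unfolding M_def using m(2) by (intro exponential_sum_power6_le m(1) a) simp
      then have "real m * M ^ 6 \<le> real m * (real ?q * ?T - real m ^ 5)" by (rule mult_left_mono) simp
      also have "\<dots> = real ?q * (real m * ?T) - real m ^ 6"
        by (simp add: right_diff_distrib mult.left_commute flip: power_Suc)
      also have "\<dots> \<le> real ?q * ?C - real m ^ 6" using T by (simp add: mult_left_mono)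
      also have "\<dots> \<le> real ?q * real m ^ 4 * (200 + 1327104 * (1 + ln (real m)))"
        using m4 by (intro collinear_triples_excess_le m(1) char True) simp
      \<comment> \<open>By \<open>ln2\<close> the bracket is at most
        \<open>(400 + 3 * 1327104) * ln m\<close>.\<close>
      also have "\<dots> \<le> real ?q * real m ^ 4 * (5000000 * ln (real m))"
        using ln2 by (intro mult_left_mono) auto
      also have "\<dots> = real m * (5000000 * (real ?q * real m ^ 3 * ln (real m)))"
        by (simp add: power3_eq_cube power4_eq_xxxx)
      finally show ?thesis using m(2) by simp
    qed
  qed
  then show ?thesis by (simp add: M_def)
qed

end

section \<open>Prime fields\<close>

text \<open>Phrased in natural numbers, so that it is a property of \<open>n\<close> and not of a
  type.\<close>

definition subset_exponential_sums_bounded :: "nat \<Rightarrow> bool" where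
  "subset_exponential_sums_bounded n \<longleftrightarrow> (\<forall>m a S. 2 \<le> m \<longrightarrow> m ^ 3 \<le> n\<^sup>2 \<longrightarrow> \<not> n dvd a \<longrightarrow>
     S \<subseteq> {..<n} \<longrightarrow> card S = m \<longrightarrow> (\<forall>h\<in>S. [h ^ m = 1] (mod n)) \<longrightarrow>
     norm (\<Sum>h\<in>S. cis (2 * pi * real (a * h) / real n)) ^ 6 \<le> 5000000 * (real n * real m ^ 3 * ln (real m)))"

definition residue_character :: "'p::prime_card mod_ring \<Rightarrow> complex" where
  "residue_character x = cis (2 * pi * of_int (to_int_mod_ring x) / real CARD('p))"

lemma cis_mod_int:
  assumes "0 < n"
  shows "cis (2 * pi * of_int (k mod int n) / real n) = cis (2 * pi * of_int k / real n)"
proof -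
  have "real_of_int k = of_int (int n * (k div int n) + k mod int n)" by simp
  also have "\<dots> = real n * of_int (k div int n) + of_int (k mod int n)"
    by (simp only: of_int_add of_int_mult of_int_of_nat_eq)
  finally have "2 * pi * of_int k / real n = 2 * pi * of_int (k div int n) + 2 * pi * of_int (k mod int n) / real n"
    using assms by (simp add: field_simps)
  then show ?thesis by (simp flip: cis_mult add: cis_multiple_2pi)
qed

lemma residue_character_of_nat:
  "residue_character (of_nat j :: 'p::prime_card mod_ring) = cis (2 * pi * real j / real CARD('p))"
proof -
  have "to_int_mod_ring (of_nat j :: 'p mod_ring) = int j mod int CARD('p)"
    by (simp add: of_nat_of_int_mod_ring of_int_mod_ring.rep_eq to_int_mod_ring.rep_eq)
  then show ?thesis using cis_mod_int[of "CARD('p)" "int j"] by (simp add: residue_character_def)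
qed

lemma additive_character_residue_character:
  "additive_character (residue_character :: 'p::prime_card mod_ring \<Rightarrow> complex)"
proof
  let ?psi = "residue_character :: 'p mod_ring \<Rightarrow> complex"
  show add: "?psi (x + y) = ?psi x * ?psi y" for x y
    using cis_mod_int[of "CARD('p)" "to_int_mod_ring x + to_int_mod_ring y"]
    by (simp add: residue_character_def to_int_mod_ring_add cis_mult ring_distribs add_divide_distrib)
  show "norm (?psi x) = 1" for x by (simp add: residue_character_def)
  have p: "2 \<le> CARD('p)" using prime_card[where 'a = 'p] by (rule prime_ge_2_nat)
  have "?psi 1 \<noteq> 1"
  proof
    assume "?psi 1 = 1"
    then have "cis (2 * pi * real 1 / real CARD('p)) = cis (2 * pi * real 0 / real CARD('p))"
      using residue_character_of_nat[of 1, where 'p = 'p] by simp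
    moreover have "inj_on (\<lambda>k. cis (2 * pi * real k / real CARD('p))) {..<CARD('p)}"
      using bij_betw_roots_unity[of "CARD('p)"] by (auto simp: bij_betw_def)
    ultimately have "(1 :: nat) = 0" using p by (elim inj_onD) auto
    then show False by simp
  qed
  moreover have "(\<Sum>x\<in>UNIV. ?psi x) = ?psi 1 * (\<Sum>x\<in>UNIV. ?psi x)"
  proof -
    have "bij (\<lambda>x :: 'p mod_ring. 1 + x)" by (rule bij_plus)
    then have "(\<Sum>x\<in>UNIV. ?psi x) = (\<Sum>x\<in>UNIV. ?psi (1 + x))" by (rule sum.reindex_bij_betw[symmetric])
    also have "\<dots> = ?psi 1 * (\<Sum>x\<in>UNIV. ?psi x)" unfolding add by (rule sum_distrib_left[symmetric])
    finally show ?thesis .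
  qed
  ultimately show "(\<Sum>x\<in>UNIV. ?psi x) = 0" by simp
qed

lemma subset_exponential_sums_bounded_card: "subset_exponential_sums_bounded CARD('p::prime_card)"
  unfolding subset_exponential_sums_bounded_def
proof (intro allI impI)
  fix m a :: nat and S :: "nat set"
  let ?n = "CARD('p)"
  let ?nat = "of_nat :: nat \<Rightarrow> 'p mod_ring"
  assume m: "2 \<le> m" "m ^ 3 \<le> ?n\<^sup>2" and a: "\<not> ?n dvd a" and S: "S \<subseteq> {..<?n}" "card S = m"
    and unity: "\<forall>h\<in>S. [h ^ m = 1] (mod ?n)"
  have eq_iff: "?nat i = ?nat j \<longleftrightarrow> [i = j] (mod ?n)" for i j
    by (simp add: of_nat_eq_iff_cong_CHAR)
  have inj: "inj_on ?nat S"
    using S(1) by (intro inj_onI) (metis eq_iff cong_def mod_less lessThan_iff subsetD)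
  have sub: "?nat ` S \<subseteq> unity_roots m"
    using unity eq_iff[of _ 1] by (auto simp: unity_roots_def simp flip: of_nat_power)
  \<comment> \<open>A field has at most \<open>m\<close> roots of \<open>x ^ m = 1\<close>, so by
    cardinality the image of \<open>S\<close> contains all of them.\<close>
  have "card (unity_roots m :: 'p mod_ring set) \<le> card (?nat ` S)"
    using card_nth_roots_le[of m "1 :: 'p mod_ring"] m(1) S(2) by (simp add: card_image[OF inj] unity_roots_def)
  then have H: "?nat ` S = unity_roots m" using sub by (intro card_seteq) auto
  interpret additive_character "residue_character :: 'p mod_ring \<Rightarrow> complex"
    by (rule additive_character_residue_character)
  have "?nat a \<noteq> 0" using a eq_iff[of a 0] by (simp add: cong_0_iff)
  moreover have "card (unity_roots m :: 'p mod_ring set) = m"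
    using S(2) card_image[OF inj] by (simp add: H)
  ultimately have "norm (\<Sum>h\<in>unity_roots m. residue_character (?nat a * h)) ^ 6
      \<le> 5000000 * (real CARD('p mod_ring) * real m ^ 3 * ln (real m))"
    using m by (intro exponential_sum_bound) simp_all
  also have "(\<Sum>h\<in>unity_roots m. residue_character (?nat a * h)) = (\<Sum>h\<in>S. cis (2 * pi * real (a * h) / real ?n))"
    unfolding H[symmetric]
    by (subst sum.reindex[OF inj]) (simp only: o_def residue_character_of_nat flip: of_nat_mult)
  finally show "norm (\<Sum>h\<in>S. cis (2 * pi * real (a * h) / real ?n)) ^ 6 \<le> 5000000 * (real ?n * real m ^ 3 * ln (real m))"
    by simp
qed

text \<open>
  A type cannot depend on the prime \<open>n\<close> of the theorem. Hence the residue field is built for one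
  fixed prime: a counterexample to the bound, if there is any. Since the bound holds for this prime,
  it holds for all of them.
\<close>

definition critical_prime :: nat where
  "critical_prime = (if \<exists>n. prime n \<and> \<not> subset_exponential_sums_bounded n
     then SOME n. prime n \<and> \<not> subset_exponential_sums_bounded n else 2)"

lemma prime_critical_prime: "prime critical_prime"
  unfolding critical_prime_def
  using someI_ex[of "\<lambda>n. prime n \<and> \<not> subset_exponential_sums_bounded n"] by auto

typedef critical_residues = "{..<critical_prime}"
  using prime_gt_0_nat[OF prime_critical_prime] by blast

lemma CARD_critical_residues: "CARD(critical_residues) = critical_prime"
  using type_definition.card[OF type_definition_critical_residues] by simp

instance critical_residues :: prime_card
  by standard (simp add: CARD_critical_residues prime_critical_prime)

lemma subset_exponential_sums_bounded_prime:
  assumes "prime n"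
  shows "subset_exponential_sums_bounded n"
proof (rule ccontr)
  assume "\<not> subset_exponential_sums_bounded n"
  with assms have ex: "\<exists>n. prime n \<and> \<not> subset_exponential_sums_bounded n" by blast
  then have "\<not> subset_exponential_sums_bounded critical_prime"
    using someI_ex[OF ex] by (simp add: critical_prime_def)
  then show False
    using subset_exponential_sums_bounded_card[where 'p = critical_residues] by (simp add: CARD_critical_residues)
qed

lemma norm_subset_exponential_sum_le:
  assumes n: "prime n" and m: "2 \<le> m" "real m \<le> real n powr (2 / 3)" and a: "\<not> n dvd a"
    and S: "S \<subseteq> {..<n}" "card S = m" "\<And>h. h \<in> S \<Longrightarrow> [h ^ m = 1] (mod n)"
  shows "norm (\<Sum>h\<in>S. cis (2 * pi * real (a * h) / real n))
    \<le> 5000000 powr (1 / 6) * (real m powr (1 / 2) * real n powr (1 / 6) * ln (real m) powr (1 / 6))"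
    (is "?M \<le> ?B")
proof -
  have pos: "0 < real n" "0 < real m" "0 < ln (real m)" using n m(1) prime_gt_0_nat by auto
  have "real (m ^ 3) \<le> (real n powr (2 / 3)) ^ 3" unfolding of_nat_power using m(2) by (rule power_mono) simp
  also have "\<dots> = real (n\<^sup>2)" using pos by (simp add: powr_power powr_numeral)
  finally have "m ^ 3 \<le> n\<^sup>2" by (simp only: of_nat_le_iff)
  then have "?M ^ 6 \<le> 5000000 * (real n * real m ^ 3 * ln (real m))"
    using subset_exponential_sums_bounded_prime[OF n] m(1) a S unfolding subset_exponential_sums_bounded_def by blast
  also have "\<dots> = ?B ^ 6"
  proof -
    have "(x powr (1 / 6)) ^ 6 = x" if "0 < x" for x :: real
      using that by (simp add: powr_power)
    moreover have "(x powr (1 / 2)) ^ 6 = x ^ 3" if "0 < x" for x :: real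
      using that by (simp add: powr_power powr_numeral)
    ultimately show ?thesis using pos by (simp add: power_mult_distrib)
  qed
  finally show ?thesis using power_mono_iff[of ?M ?B 6] by simp
qed

section \<open>The mutual coherence\<close>

text \<open>
  Column \<open>j\<close> and column \<open>n + j\<close> are the real and imaginary parts, stacked, of the \<open>j\<close>-th Fourier
  column and of its multiple by \<open>\<i>\<close>.
\<close>

definition frame_entry :: "nat \<Rightarrow> (nat \<Rightarrow> nat) \<Rightarrow> nat \<Rightarrow> nat \<Rightarrow> complex" where
  "frame_entry n k i s = (if i < n then 1 else \<i>) * cis (2 * pi * real (k s * Suc (i mod n)) / real n)"

lemma partial_fourier_mat_index:
  "s < m \<Longrightarrow> j < n \<Longrightarrow> partial_fourier_mat m n k $$ (s, j) = cis (2 * pi * real (k s * Suc j) / real n)"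
  unfolding partial_fourier_mat_def cis_conv_exp
  by (simp add: algebra_simps)

lemma real_frame_mat_index:
  assumes "r < 2 * m" "i < 2 * n"
  shows "real_frame_mat m n k $$ (r, i) =
    (if r < m then Re (frame_entry n k i r) else Im (frame_entry n k i (r - m))) / sqrt (real m)"
proof -
  have dims: "dim_row (partial_fourier_mat m n k) = m" "dim_col (partial_fourier_mat m n k) = n"
    by (simp_all add: partial_fourier_mat_def)
  have "i mod n = (if i < n then i else i - n)" using assms(2) by (simp add: mod_if)
  moreover have "r - m < m" "i - n < n" if "\<not> r < m" "\<not> i < n" using that assms by auto
  ultimately show ?thesis
    using assms unfolding real_frame_mat_def Let_def
    by (auto simp: dims frame_entry_def partial_fourier_mat_index)
qed

lemma sum_lessThan_add:
  fixes f :: "nat \<Rightarrow> 'a::comm_monoid_add"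
  shows "(\<Sum>r<a + b. f r) = (\<Sum>r<a. f r) + (\<Sum>r<b. f (a + r))"
  by (induction b) (simp_all add: add.assoc)

text \<open>Stacking real and imaginary parts yields the real part of the hermitian product:
  \<open>Re z * Re w + Im z * Im w = Re (z * cnj w)\<close>.\<close>

lemma col_real_frame_mat_scalar_prod:
  assumes "i < 2 * n" "j < 2 * n"
  shows "col (real_frame_mat m n k) i \<bullet> col (real_frame_mat m n k) j
    = Re (\<Sum>s<m. frame_entry n k i s * cnj (frame_entry n k j s)) / real m"
proof -
  let ?V = "real_frame_mat m n k"
  have V: "dim_row ?V = 2 * m" "dim_col ?V = 2 * n" using real_frame_mat_carrier[of m n k] by auto
  have "col ?V i \<bullet> col ?V j = (\<Sum>r<m + m. ?V $$ (r, i) * ?V $$ (r, j))"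
    unfolding scalar_prod_def using assms by (simp add: V atLeast0LessThan mult_2)
  also have "\<dots> = (\<Sum>r<m. ?V $$ (r, i) * ?V $$ (r, j)) + (\<Sum>r<m. ?V $$ (m + r, i) * ?V $$ (m + r, j))"
    by (rule sum_lessThan_add)
  also have "\<dots> = (\<Sum>r<m. Re (frame_entry n k i r * cnj (frame_entry n k j r)) / real m)"
    unfolding sum.distrib[symmetric]
    using assms by (intro sum.cong refl) (simp add: real_frame_mat_index field_simps)
  finally show ?thesis by (simp add: sum_divide_distrib)
qed

lemma subgroup_freqs_subset:
  assumes n: "prime n" and m: "m dvd n - 1" and g: "residue_primroot n g"
  shows "subgroup_freqs n m g \<subseteq> {h. h < n \<and> [h ^ m = 1] (mod n)}"
proof -
  have "coprime n g" using g by (auto simp: residue_primroot_def)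
  then have cop: "\<not> n dvd g" using n by (metis coprime_absorb_left not_prime_unit)
  have "[(g ^ (t * ((n - 1) div m)) mod n) ^ m = 1] (mod n)" for t
  proof -
    have "t * ((n - 1) div m) * m = (n - 1) * t" using m by simp
    then have "(g ^ (t * ((n - 1) div m))) ^ m = (g ^ (n - 1)) ^ t" by (metis power_mult)
    also have "[(g ^ (n - 1)) ^ t = 1 ^ t] (mod n)" by (intro cong_pow fermat_theorem n cop)
    finally show ?thesis by (simp add: cong_def power_mod)
  qed
  then show ?thesis using prime_gt_0_nat[OF n] by (auto simp: subgroup_freqs_def)
qed

theorem theorem4:
  "\<exists>C::real. C > 0 \<and>
     (\<forall>(m::nat) (n::nat) (g::nat) (k::nat \<Rightarrow> nat).
        2 \<le> m \<longrightarrow> prime n \<longrightarrow> m dvd (n - 1) \<longrightarrow> real m \<le> real n powr (2 / 3) \<longrightarrow>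
        residue_primroot n g \<longrightarrow>
        bij_betw k {..<m} (subgroup_freqs n m g) \<longrightarrow>
        mutual_coherence (real_frame_mat m n k)
          \<le> C * real m powr (- 1 / 2) * real n powr (1 / 6) * ln (real m) powr (1 / 6))"
proof (intro exI[of _ "5000000 powr (1 / 6)"] conjI allI impI)
  fix m n g :: nat and k :: "nat \<Rightarrow> nat"
  assume m: "2 \<le> m" and n: "prime n" and dvd: "m dvd (n - 1)" and mn: "real m \<le> real n powr (2 / 3)"
    and g: "residue_primroot n g" and k: "bij_betw k {..<m} (subgroup_freqs n m g)"
  let ?V = "real_frame_mat m n k"
  let ?B = "5000000 powr (1 / 6) * real m powr (- 1 / 2) * real n powr (1 / 6) * ln (real m) powr (1 / 6)"
  have n2: "2 \<le> n" by (rule prime_ge_2_nat[OF n])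
  have V: "dim_col ?V = 2 * n" using real_frame_mat_carrier[of m n k] by auto
  have S: "subgroup_freqs n m g \<subseteq> {..<n}" "card (subgroup_freqs n m g) = m"
      "\<And>h. h \<in> subgroup_freqs n m g \<Longrightarrow> [h ^ m = 1] (mod n)"
    using subgroup_freqs_subset[OF n dvd g] bij_betw_same_card[OF k] by auto
  have bound: "norm (\<Sum>s<m. cis (2 * pi * real (a * k s) / real n)) / real m \<le> ?B" if "\<not> n dvd a" for a
  proof -
    have "norm (\<Sum>s<m. cis (2 * pi * real (a * k s) / real n))
      = norm (\<Sum>h\<in>subgroup_freqs n m g. cis (2 * pi * real (a * h) / real n))"
      by (subst sum.reindex_bij_betw[OF k]) simp
    also have "\<dots> \<le> 5000000 powr (1 / 6) * (real m powr (1 / 2) * real n powr (1 / 6) * ln (real m) powr (1 / 6))"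
      by (rule norm_subset_exponential_sum_le[OF n m mn that S])
    also have "real m powr (1 / 2) = real m * real m powr (- 1 / 2)"
      using m by (simp add: powr_mult_base)
    finally show ?thesis using m by (simp add: field_simps)
  qed
  have "\<bar>col ?V i \<bullet> col ?V j\<bar> \<le> ?B" if ij: "i < 2 * n" "j < 2 * n" "i \<noteq> j" for i j
  proof -
    \<comment> \<open>The difference of the column indices, shifted by \<open>n\<close> to stay a
      natural number; the shift changes phases by multiples of \<open>2 * pi\<close>.\<close>
    define a where "a = Suc (i mod n) + (n - Suc (j mod n))"
    define w where "w = (if i < n then 1 else \<i>) * cnj (if j < n then 1 else \<i>)"
    have entry: "frame_entry n k i s * cnj (frame_entry n k j s) = w * cis (2 * pi * real (a * k s) / real n)" for s
    proof -
      have "j mod n < n" using n2 by simp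
      then have "a + Suc (j mod n) = Suc (i mod n) + n" unfolding a_def by linarith
      then have "k s * (a + Suc (j mod n)) = k s * (Suc (i mod n) + n)" by (rule arg_cong)
      then have "real (a * k s) + real (k s * Suc (j mod n)) = real (k s * Suc (i mod n)) + real n * real (k s)"
        unfolding distrib_left by (metis mult.commute of_nat_add of_nat_mult)
      then have "real (a * k s) = real (k s * Suc (i mod n)) - real (k s * Suc (j mod n)) + real n * real (k s)"
        by linarith
      moreover have "2 * pi * (x - y + real n * z) / real n = 2 * pi * x / real n + - (2 * pi * y / real n) + 2 * pi * z" for x y z
        using n2 by (simp add: field_simps)
      ultimately have "2 * pi * real (a * k s) / real n = 2 * pi * real (k s * Suc (i mod n)) / real n
          + - (2 * pi * real (k s * Suc (j mod n)) / real n) + 2 * pi * real (k s)"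
        by (simp only:)
      then have "cis (2 * pi * real (a * k s) / real n) = cis (2 * pi * real (k s * Suc (i mod n)) / real n)
          * cis (- (2 * pi * real (k s * Suc (j mod n)) / real n)) * cis (2 * pi * real (k s))"
        by (simp only: cis_mult)
      then show ?thesis unfolding frame_entry_def w_def by (simp add: cis_cnj cis_multiple_2pi)
    qed
    have prod: "col ?V i \<bullet> col ?V j = Re (w * (\<Sum>s<m. cis (2 * pi * real (a * k s) / real n))) / real m"
      unfolding col_real_frame_mat_scalar_prod[OF ij(1,2)] entry sum_distrib_left ..
    show ?thesis
    proof (cases "i mod n = j mod n")
      case True
      \<comment> \<open>Distinct columns of equal residue are a Fourier column and its multiple by
        \<open>\<i>\<close>: the sum is the real number \<open>m\<close>, and the imaginary
        \<open>w\<close> leaves real part 0.\<close>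
      have "w = \<i> \<or> w = - \<i>"
        using True ij by (auto simp: w_def mod_if split: if_splits)
      moreover have "cis (2 * pi * real (a * k s) / real n) = 1" for s
      proof -
        have "a = n" using True n2 by (simp add: a_def Suc_le_eq)
        then have eq: "2 * pi * real (a * k s) / real n = 2 * pi * real (k s)" using n2 by simp
        show ?thesis unfolding eq by (rule cis_multiple_2pi) simp
      qed
      ultimately have "col ?V i \<bullet> col ?V j = 0" unfolding prod by auto
      then show ?thesis by simp
    next
      case False
      have "\<not> n dvd a"
      proof
        assume "n dvd a"
        then have "(i mod n + n) mod n = j mod n"
        proof -
          have "j mod n < n" using n2 by simp
          then have "a + j mod n = i mod n + n" unfolding a_def by linarith
          then show ?thesis using \<open>n dvd a\<close> by (metis dvd_eq_mod_eq_0 mod_add_left_eq add_0 mod_mod_trivial)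
        qed
        with False show False by simp
      qed
      have "norm w = 1" by (simp add: w_def norm_mult)
      have "\<bar>col ?V i \<bullet> col ?V j\<bar> \<le> norm (w * (\<Sum>s<m. cis (2 * pi * real (a * k s) / real n))) / real m"
        unfolding prod abs_divide abs_of_nat by (intro divide_right_mono abs_Re_le_cmod) simp
      also have "\<dots> = norm (\<Sum>s<m. cis (2 * pi * real (a * k s) / real n)) / real m"
        by (simp add: norm_mult \<open>norm w = 1\<close>)
      also have "\<dots> \<le> ?B" by (rule bound[OF \<open>\<not> n dvd a\<close>])
      finally show ?thesis .
    qed
  qed
  moreover have "finite {\<bar>col ?V i \<bullet> col ?V j\<bar> | i j. i < dim_col ?V \<and> j < dim_col ?V \<and> i \<noteq> j}"
    by (rule finite_subset[of _ "(\<lambda>(i, j). \<bar>col ?V i \<bullet> col ?V j\<bar>) ` ({..<dim_col ?V} \<times> {..<dim_col ?V})"]) auto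
  moreover have "\<exists>i j. i < dim_col ?V \<and> j < dim_col ?V \<and> i \<noteq> j"
    using n2 by (intro exI[of _ 0] exI[of _ 1]) (simp add: V)
  ultimately show "mutual_coherence ?V \<le> ?B"
    unfolding mutual_coherence_def by (subst Max_le_iff) (auto simp: V)
qed simp

end
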